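(* Let $f_1,\dots,f_m:\mathbb{R}^d\to\mathbb{R}$, $\varepsilon,\delta\ge0$, $0<M\le+\infty$, $0<\rho\le L<+\infty$, $K\ge2$, $\alpha\in(0,1]$, $\{\boldsymbol\beta^\star_k\}_{k=1}^K\subseteq\mathbb{R}^d$, $\{z^\star_j\}_{j=1}^m\subseteq[K]$, $\{\boldsymbol\theta^\star_j\}\subseteq\mathbb{R}^d$, and suppose there is $S\subseteq[m]$ such that each $f_j$, $j\in S$, is $(\boldsymbol\theta^\star_j,M,\rho,L)$-regular, $\max_{j\in S}\|\boldsymbol\theta^\star_j-\boldsymbol\beta^\star_{z^\star_j}\|_2\le\delta$ and $|S^c|\le\varepsilon m$. Let $\kappa=L/\rho$ and $T(k)=\{j\in[m]:z^\star_j=k\}$. Suppose $\varepsilon\le\frac{\alpha}{6\kappa K^2}$, $\min_k|T(k)|\ge\frac{7\alpha m}{6K}$ and $$\frac{12\kappa K}{\sqrt\alpha}\max_{j\in[m]}\|\nabla f_j(\boldsymbol\theta^\star_j)\|_2<\lambda<\frac\rho6\min\Big\{M,\min_{k\ne l}\|\boldsymbol\beta^\star_k-\boldsymbol\beta^\star_l\|_2\Big\}.$$ Let $(\widehat{\boldsymbol\Theta},\widehat{\boldsymbol B},\widehat{\boldsymbol z})$ minimize $\sum_{j=1}^m[f_j(\boldsymbol\theta_j)+\lambda\|\boldsymbol\beta_{z_j}-\boldsymbol\theta_j\|_2]$ over $\boldsymbol\Theta\in\mathbb{R}^{d\times m}$, $\boldsymbol B\in\mathbb{R}^{d\times K}$,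 $\boldsymbol z\in[K]^m$ subject to $\min_{k\in[K]}|\{j:z_j=k\}|\ge\alpha m/K$. Then for all $j\in S$, $$\|\widehat{\boldsymbol\theta}_j-\boldsymbol\theta^\star_j\|_2\le\frac{\|\sum_{k\in T(z^\star_j)\cap S}\nabla f_k(\boldsymbol\theta^\star_k)\|_2}{\rho|T(z^\star_j)\cap S|}+\min\Big\{\frac{55\kappa^2K\delta}{\sqrt\alpha},\frac{11\lambda}{5\rho}\Big\}+\frac{\lambda|S^c|}{\rho|T(z^\star_j)\cap S|}.$$ Moreover, if $\delta\le\sqrt\alpha\lambda/(100\kappa KL)$, there exists a permutation $\tau$ of $[K]$ such that $\widehat z_j=\tau(z^\star_j)$ and $\widehat{\boldsymbol\theta}_j=\widehat{\boldsymbol\beta}_{\widehat z_j}$ for all $j\in S$.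
   Context: $\boldsymbol\beta_k$ denotes the $k$-th column of $\boldsymbol B$. A function $f:\mathbb{R}^d\to\mathbb{R}$ is $(\boldsymbol\theta^\star,M,\rho,L)$-regular if it is convex and twice differentiable, $\rho\boldsymbol I\preceq\nabla^2f(\boldsymbol\theta)\preceq L\boldsymbol I$ for all $\boldsymbol\theta$ in the closed ball $B(\boldsymbol\theta^\star,M)$, and $\|\nabla f(\boldsymbol\theta^\star)\|_2\le\rho M/2$. The functions $f_j$, $j\in S^c$, are assumed differentiable at $\boldsymbol\theta^\star_j$ (so that the hypothesis makes sense). *)

theory Defs
  imports "HOL-Analysis.Analysis"
begin

text \<open>Gradient of a real-valued function on a Euclidean space (meaningful where f is differentiable).\<close>
definition grad :: "('a::euclidean_space \<Rightarrow> real) \<Rightarrow> 'a \<Rightarrow> 'a" where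
  "grad f x = (SOME D. GDERIV f x :> D)"

definition ecball :: "'a::metric_space \<Rightarrow> ereal \<Rightarrow> 'a set" where
  "ecball c M = {x. ereal (dist c x) \<le> M}"

definition regular :: "('a::euclidean_space \<Rightarrow> real) \<Rightarrow> 'a \<Rightarrow> ereal \<Rightarrow> real \<Rightarrow> real \<Rightarrow> bool" where
  "regular f \<theta> M \<rho> L \<longleftrightarrow>
     convex_on UNIV f \<and>
     (\<forall>x. f differentiable (at x)) \<and>
     (\<exists>H. (\<forall>x. (grad f has_derivative H x) (at x)) \<and>
          (\<forall>x\<in>ecball \<theta> M. \<forall>h. \<rho> * (norm h)\<^sup>2 \<le> h \<bullet> H x h \<and> h \<bullet> H x h \<le> L * (norm h)\<^sup>2)) \<and>
     ereal (norm (grad f \<theta>)) \<le> ereal \<rho> * M / 2"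

definition objective :: "nat \<Rightarrow> (nat \<Rightarrow> 'a::euclidean_space \<Rightarrow> real) \<Rightarrow> real \<Rightarrow>
    (nat \<Rightarrow> 'a) \<Rightarrow> (nat \<Rightarrow> 'a) \<Rightarrow> (nat \<Rightarrow> nat) \<Rightarrow> real" where
  "objective m f lam \<Theta> B z = (\<Sum>j\<in>{1..m}. f j (\<Theta> j) + lam * norm (B (z j) - \<Theta> j))"

definition feasible_z :: "nat \<Rightarrow> nat \<Rightarrow> real \<Rightarrow> (nat \<Rightarrow> nat) \<Rightarrow> bool" where
  "feasible_z m K \<alpha> z \<longleftrightarrow> (\<forall>j\<in>{1..m}. z j \<in> {1..K}) \<and>
     (\<forall>k\<in>{1..K}. real (card {j\<in>{1..m}. z j = k}) \<ge> \<alpha> * real m / real K)"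

end

(* Write w = lam / L. Convexity gives, for a regular f and every slope b in [0, lam], the tangent bound
     f x + lam |c - x| >= f theta + b |c - theta| - (b + G)^2 / (2 rho),
   so the penalized loss of a good task grows linearly in the distance of its center, while replacing
   the center of an outlier costs at most lam times the displacement, whatever its loss.
   If delta is large, the first-order condition |grad f_j (theta_hat_j)| <= lam already yields the
   bound 11 lam / (5 rho). Otherwise the estimator is compared with three competitors.
   (1) The true centers, each outlier being sent to the true center closest to its estimated one:
       the worst estimated center has about alpha m / K good tasks against few outliers, so all
       estimated centers lie within 7 w / 20 of true ones, and every true center is hit.
   (2) The estimated centers with the good tasks relabelled correctly: a wrong label costs strictly
       more, so the labels are right; then |grad f_j| < lam at the center and the penalty collapses
       theta_hat_j onto it.
   (3) One center moved freely: the gradients of its good tasks sum to at most lam |S^c| in norm, and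
       strong monotonicity turns this into the error bound. *)
theory Submission
  imports Defs
begin

section \<open>Gradients, slopes and tangents\<close>

text \<open>\<open>grad\<close> is a choice, so a gradient has to be exhibited: a linear functional
  on a Euclidean space is the inner product with the vector of its values on the basis.\<close>

lemma GDERIV_grad:
  fixes f :: "'a::euclidean_space \<Rightarrow> real"
  assumes "f differentiable (at x)"
  shows "GDERIV f x :> grad f x"
proof -
  obtain f' where f': "(f has_derivative f') (at x)"
    using assms by (auto simp: differentiable_def)
  then interpret bounded_linear f' by (rule has_derivative_bounded_linear)
  have "f' h = h \<bullet> (\<Sum>b\<in>Basis. f' b *\<^sub>R b)" for h
  proof -
    have "f' h = f' (\<Sum>b\<in>Basis. (h \<bullet> b) *\<^sub>R b)" by (simp add: euclidean_representation)
    also have "\<dots> = h \<bullet> (\<Sum>b\<in>Basis. f' b *\<^sub>R b)"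
      by (simp only: sum scaleR inner_sum_right inner_scaleR_right real_scaleR_def mult.commute)
    finally show ?thesis .
  qed
  then obtain D where D: "f' = (\<lambda>h. h \<bullet> D)" by blast
  have "GDERIV f x :> D" using f' unfolding gderiv_def D .
  then show ?thesis unfolding grad_def by (rule someI[where P = "\<lambda>D. GDERIV f x :> D"])
qed

lemma GDERIV_along_line:
  fixes f :: "'a::real_inner \<Rightarrow> real"
  assumes "GDERIV f (x + t *\<^sub>R v) :> D"
  shows "((\<lambda>t. f (x + t *\<^sub>R v)) has_real_derivative v \<bullet> D) (at t)"
proof -
  have line: "((\<lambda>t. x + t *\<^sub>R v) has_derivative (\<lambda>t. t *\<^sub>R v)) (at t)"
    by (auto intro!: derivative_eq_intros)
  have "((\<lambda>t. f (x + t *\<^sub>R v)) has_derivative (\<lambda>h. (h *\<^sub>R v) \<bullet> D)) (at t)"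
    by (rule has_derivative_compose[OF line, where g = f and g' = "\<lambda>h. h \<bullet> D"])
       (rule assms[unfolded gderiv_def])
  then show ?thesis by (rule has_derivative_imp_has_field_derivative) simp
qed

text \<open>Walking from \<open>x\<close> against the gradient, \<open>f\<close> initially falls at
  the rate of the squared norm of \<open>D\<close>. If \<open>norm D\<close> exceeded
  \<open>c\<close>, a short step would descend by more than \<open>le\<close> permits.\<close>

lemma norm_gradient_le_of_slope:
  fixes f :: "'a::real_inner \<Rightarrow> real"
  assumes D: "GDERIV f x :> D" and c: "0 \<le> c" and le: "\<And>y. f x \<le> f y + c * norm (y - x)"
  shows "norm D \<le> c"
proof -
  let ?p = "\<lambda>t. f (x + t *\<^sub>R (- D)) + c * t * norm D"
  have "((\<lambda>t. f (x + t *\<^sub>R (- D))) has_real_derivative (- D) \<bullet> D) (at 0)"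
    by (rule GDERIV_along_line) (use D in simp)
  then have d: "(?p has_real_derivative (- D) \<bullet> D + c * norm D) (at 0)"
    by (auto intro!: derivative_eq_intros)
  have "0 \<le> (- D) \<bullet> D + c * norm D"
  proof (rule ccontr)
    assume "\<not> ?thesis"
    then obtain e where e: "e > 0" "\<And>h. 0 < h \<Longrightarrow> h < e \<Longrightarrow> ?p (0 + h) < ?p 0"
      using DERIV_neg_dec_right[OF d] by (auto simp: not_le)
    have "?p (0 + e/2) < ?p 0" by (rule e(2)) (use e(1) in auto)
    moreover have "f x \<le> f (x + (e/2) *\<^sub>R (- D)) + c * norm (x + (e/2) *\<^sub>R (- D) - x)" by (rule le)
    ultimately show False using e(1) by (simp add: mult.assoc)
  qed
  then have "norm D * norm D \<le> c * norm D"
    by (simp add: power2_norm_eq_inner[symmetric] power2_eq_square)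
  then show ?thesis
    using c by (cases "norm D = 0") (auto simp: mult_le_cancel_right)
qed

lemma convex_on_ge_tangent:
  fixes f :: "'a::real_inner \<Rightarrow> real"
  assumes conv: "convex_on UNIV f" and D: "GDERIV f x :> D"
  shows "f x + (y - x) \<bullet> D \<le> f y"
proof -
  let ?p = "\<lambda>t. f (x + t *\<^sub>R (y - x))"
  have "convex_on UNIV ?p"
  proof (rule convex_onI)
    fix t a b :: real assume "0 < t" "t < 1"
    moreover have "x + ((1 - t) *\<^sub>R a + t *\<^sub>R b) *\<^sub>R (y - x)
        = (1 - t) *\<^sub>R (x + a *\<^sub>R (y - x)) + t *\<^sub>R (x + b *\<^sub>R (y - x))"
      by (simp add: algebra_simps)
    ultimately show "?p ((1 - t) *\<^sub>R a + t *\<^sub>R b) \<le> (1 - t) * ?p a + t * ?p b"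
      using convex_onD[OF conv, of t] by simp
  qed simp
  moreover have "(?p has_real_derivative (y - x) \<bullet> D) (at 0)"
    by (rule GDERIV_along_line) (use D in simp)
  ultimately have "?p 1 - ?p 0 \<ge> (y - x) \<bullet> D * (1 - 0)"
    by (intro convex_on_imp_above_tangent[where A = UNIV]) auto
  then show ?thesis by simp
qed

section \<open>Taylor bounds and gradient estimates for regular functions\<close>

lemma regular_differentiable: "regular f \<theta> M \<rho> L \<Longrightarrow> f differentiable (at x)"
  by (simp add: regular_def)

lemma regular_GDERIV: "regular f \<theta> M \<rho> L \<Longrightarrow> GDERIV f x :> grad f x"
  by (simp add: regular_differentiable GDERIV_grad)

lemma regular_ge_tangent:
  assumes "regular f \<theta> M \<rho> L"
  shows "f x + (y - x) \<bullet> grad f x \<le> f y"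
  using convex_on_ge_tangent[OF _ regular_GDERIV[OF assms]] assms by (simp add: regular_def)

lemma mem_ecball_iff: "x \<in> ecball c M \<longleftrightarrow> ereal (norm (x - c)) \<le> M"
  for c :: "'a::real_normed_vector"
  by (simp add: ecball_def dist_norm norm_minus_commute)

lemma center_mem_ecball: "0 \<le> M \<Longrightarrow> c \<in> ecball c M"
  by (simp add: ecball_def zero_ereal_def)

lemma segment_mem_ecball:
  fixes x y :: "'a::real_normed_vector"
  assumes x: "x \<in> ecball c M" and y: "y \<in> ecball c M" and t: "0 \<le> t" "t \<le> 1"
  shows "x + t *\<^sub>R (y - x) \<in> ecball c M"
proof -
  have "x + t *\<^sub>R (y - x) - c = (1 - t) *\<^sub>R (x - c) + t *\<^sub>R (y - c)"
    by (simp add: algebra_simps)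
  then have "norm (x + t *\<^sub>R (y - x) - c) \<le> (1 - t) * norm (x - c) + t * norm (y - c)"
    using t norm_triangle_ineq[of "(1 - t) *\<^sub>R (x - c)" "t *\<^sub>R (y - c)"] by simp
  also have "\<dots> \<le> max (norm (x - c)) (norm (y - c))"
    using t by (intro convex_bound_le) auto
  finally have "ereal (norm (x + t *\<^sub>R (y - x) - c)) \<le> max (ereal (norm (x - c))) (ereal (norm (y - c)))"
    by (simp add: max_def split: if_splits)
  also have "\<dots> \<le> M" using x y by (simp add: mem_ecball_iff)
  finally show ?thesis by (simp add: mem_ecball_iff)
qed

text \<open>Taylor expansion of order two with Lagrange remainder along the segment from
  \<open>x\<close> to \<open>y\<close>. The segment stays in the ball, so the Hessian bounds apply
  at the intermediate point.\<close>

lemma regular_taylor: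
  assumes reg: "regular f \<theta> M \<rho> L" and x: "x \<in> ecball \<theta> M" and y: "y \<in> ecball \<theta> M"
  shows "\<rho> / 2 * (norm (y - x))\<^sup>2 \<le> f y - f x - (y - x) \<bullet> grad f x"
    and "f y - f x - (y - x) \<bullet> grad f x \<le> L / 2 * (norm (y - x))\<^sup>2"
proof -
  obtain H where H: "\<And>x. (grad f has_derivative H x) (at x)"
    "\<And>x h. x \<in> ecball \<theta> M \<Longrightarrow> \<rho> * (norm h)\<^sup>2 \<le> h \<bullet> H x h"
    "\<And>x h. x \<in> ecball \<theta> M \<Longrightarrow> h \<bullet> H x h \<le> L * (norm h)\<^sup>2"
    using reg unfolding regular_def by blast
  let ?v = "y - x"
  let ?x = "\<lambda>t::real. x + t *\<^sub>R ?v"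
  \<comment> \<open>The successive derivatives of \<open>f\<close> along the segment, in the form
    that the Maclaurin formula expects.\<close>
  define D where "D = (\<lambda>(i::nat) t. if i = 0 then f (?x t) else if i = 1 then ?v \<bullet> grad f (?x t)
                              else ?v \<bullet> H (?x t) ?v)"
  have d1: "((\<lambda>t. f (?x t)) has_real_derivative ?v \<bullet> grad f (?x t)) (at t)" for t
    by (rule GDERIV_along_line[OF regular_GDERIV[OF reg]])
  have d2: "((\<lambda>t. ?v \<bullet> grad f (?x t)) has_real_derivative ?v \<bullet> H (?x t) ?v) (at t)" for t
  proof -
    have line: "(?x has_derivative (\<lambda>s. s *\<^sub>R ?v)) (at t)" by (auto intro!: derivative_eq_intros)
    have "((\<lambda>t. grad f (?x t)) has_derivative (\<lambda>s. H (?x t) (s *\<^sub>R ?v))) (at t)"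
      by (rule has_derivative_compose[OF line, where g = "grad f" and g' = "H (?x t)"]) (rule H(1))
    then have "((\<lambda>t. ?v \<bullet> grad f (?x t)) has_derivative (\<lambda>s. ?v \<bullet> H (?x t) (s *\<^sub>R ?v))) (at t)"
      by (rule has_derivative_inner_right)
    moreover have "H (?x t) (s *\<^sub>R ?v) = s *\<^sub>R H (?x t) ?v" for s
      using has_derivative_bounded_linear[OF H(1)] by (simp add: linear_simps)
    ultimately show ?thesis
      by (auto intro: has_derivative_imp_has_field_derivative)
  qed
  have "\<exists>t. 0 < t \<and> t \<le> 1 \<and> f (?x 1) = (\<Sum>i<2. D i 0 / fact i * 1 ^ i) + D 2 t / fact 2 * 1 ^ 2"
  proof (rule Maclaurin2)
    show "\<forall>i t. i < 2 \<and> 0 \<le> t \<and> t \<le> 1 \<longrightarrow> DERIV (D i) t :> D (Suc i) t"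
      using d1 d2 by (auto simp: D_def less_2_cases_iff)
  qed (auto simp: D_def)
  then obtain t where t: "0 < t" "t \<le> 1" "f y - f x - ?v \<bullet> grad f x = ?v \<bullet> H (?x t) ?v / 2"
    by (auto simp: D_def numeral_2_eq_2)
  have "?x t \<in> ecball \<theta> M" using segment_mem_ecball[OF x y] t by simp
  from H(2)[OF this, of ?v] H(3)[OF this, of ?v] t
  show "\<rho> / 2 * (norm (y - x))\<^sup>2 \<le> f y - f x - (y - x) \<bullet> grad f x"
    and "f y - f x - (y - x) \<bullet> grad f x \<le> L / 2 * (norm (y - x))\<^sup>2"
    by auto
qed

text \<open>Sum of the two lower Taylor bounds, one expanded at \<open>x\<close> and one at
  \<open>y\<close>.\<close>

lemma regular_grad_strongly_monotone:
  assumes reg: "regular f \<theta> M \<rho> L" and x: "x \<in> ecball \<theta> M" and y: "y \<in> ecball \<theta> M"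
  shows "\<rho> * (norm (y - x))\<^sup>2 \<le> (y - x) \<bullet> (grad f y - grad f x)"
proof -
  have "(x - y) \<bullet> grad f y = - ((y - x) \<bullet> grad f y)" by (simp add: inner_diff_left)
  then show ?thesis
    using regular_taylor(1)[OF reg x y] regular_taylor(1)[OF reg y x]
    by (simp add: inner_diff_right norm_minus_commute)
qed

text \<open>The Hessian is not assumed symmetric, so the Lipschitz bound is not read off its quadratic
  form. Instead, \<open>f - \<langle>\<nabla>f y, \<cdot>\<rangle>\<close> is minimal at \<open>y\<close>, which limits how far a step from \<open>x\<close>
  of length \<open>norm (x - y)\<close> against its gradient can descend.\<close>
lemma regular_grad_lipschitz:
  assumes reg: "regular f \<theta> M \<rho> L" and L: "0 \<le> L" and x: "x \<in> ecball \<theta> M" and y: "y \<in> ecball \<theta> M"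
    and room: "ereal (norm (x - \<theta>) + norm (x - y)) \<le> M"
  shows "norm (grad f x - grad f y) \<le> L * norm (x - y)"
proof (cases "x = y \<or> grad f x = grad f y")
  case True
  then show ?thesis using L by auto
next
  case False
  define v where "v = grad f x - grad f y"
  define r where "r = norm (x - y)"
  define u where "u = x - (r / norm v) *\<^sub>R v"
  have pos: "0 < r" "0 < norm v" using False by (auto simp: r_def v_def)
  have ux: "norm (u - x) = r" using pos by (simp add: u_def)
  \<comment> \<open>By \<open>room\<close>, a step of length \<open>r\<close> from \<open>x\<close>
    stays in the ball in every direction, so the upper Taylor bound is available at
    \<open>u\<close>.\<close>
  have "norm (u - \<theta>) \<le> norm (x - \<theta>) + r"
    using norm_triangle_ineq[of "u - x" "x - \<theta>"] ux by simp
  then have u: "u \<in> ecball \<theta> M"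
    using room unfolding mem_ecball_iff r_def by (meson ereal_less_eq(3) order_trans)
  have "f y + (u - y) \<bullet> grad f y \<le> f u" by (rule regular_ge_tangent[OF reg])
  moreover have "f u - f x - (u - x) \<bullet> grad f x \<le> L / 2 * r\<^sup>2"
    using regular_taylor(2)[OF reg x u] ux by simp
  moreover have "f x - f y - (x - y) \<bullet> grad f y \<le> L / 2 * r\<^sup>2"
    using regular_taylor(2)[OF reg y x] by (simp add: r_def)
  moreover have "(u - x) \<bullet> grad f x - (u - y) \<bullet> grad f y + (x - y) \<bullet> grad f y = (u - x) \<bullet> v"
    by (simp add: v_def inner_diff_left inner_diff_right)
  moreover have "(u - x) \<bullet> v = - (r * norm v)"
    using pos by (simp add: u_def power2_norm_eq_inner[symmetric] power2_eq_square)
  ultimately have "r * norm v \<le> L * r\<^sup>2" by linarith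
  then have "r * norm v \<le> r * (L * r)" by (simp add: power2_eq_square mult.left_commute)
  then show ?thesis using pos by (simp add: v_def r_def)
qed

section \<open>Linear growth of regular functions and of penalized losses\<close>

text \<open>Up to distance \<open>R\<close> the quadratic growth lies above its tangent line of
  slope \<open>a\<close>. Beyond \<open>R\<close>, convexity along the ray preserves the average
  slope \<open>\<rho> * R / 2 - G\<close> attained at distance \<open>R\<close>, and the last
  assumption makes it at least \<open>a - G\<close>.\<close>

lemma regular_linear_lower_bound:
  assumes reg: "regular f \<theta> M \<rho> L" and M: "ereal R \<le> M" and R: "0 < R" and \<rho>: "0 < \<rho>"
    and G: "norm (grad f \<theta>) \<le> G" and a: "2 * a \<le> \<rho> * R"
  shows "f \<theta> + (a - G) * norm (x - \<theta>) - a\<^sup>2 / (2 * \<rho>) \<le> f x"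
proof -
  have M0: "0 \<le> M" using M R by (metis ereal_less_eq(3) less_imp_le order_trans zero_ereal_def)
  define t where "t = norm (x - \<theta>)"
  have near: "f \<theta> - G * norm (z - \<theta>) + \<rho> / 2 * (norm (z - \<theta>))\<^sup>2 \<le> f z" if "norm (z - \<theta>) \<le> R" for z
  proof -
    have "z \<in> ecball \<theta> M" using that M by (simp add: mem_ecball_iff order_trans[OF _ M])
    then have "\<rho> / 2 * (norm (z - \<theta>))\<^sup>2 \<le> f z - f \<theta> - (z - \<theta>) \<bullet> grad f \<theta>"
      using regular_taylor(1)[OF reg center_mem_ecball[OF M0]] by blast
    moreover have "\<bar>(z - \<theta>) \<bullet> grad f \<theta>\<bar> \<le> norm (z - \<theta>) * G"
      using Cauchy_Schwarz_ineq2 G by (meson mult_left_mono norm_ge_zero order_trans)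
    ultimately show ?thesis by (simp add: mult.commute)
  qed
  show ?thesis
  proof (cases "t \<le> R")
    case True
    have "0 \<le> (\<rho> * t - a)\<^sup>2 / (2 * \<rho>)" using \<rho> by simp
    also have "\<dots> = \<rho> / 2 * t\<^sup>2 - a * t + a\<^sup>2 / (2 * \<rho>)"
      using \<rho> by (simp add: field_simps power2_eq_square)
    finally show ?thesis using near[of x] True by (simp add: t_def algebra_simps)
  next
    case False
    \<comment> \<open>The factor that pulls \<open>x\<close> back along the ray to distance exactly
      \<open>R\<close> from \<open>\<theta>\<close>.\<close>
    define s where "s = R / t"
    have s: "0 < s" "s \<le> 1" "s * t = R" using False R by (auto simp: s_def)
    define z where "z = (1 - s) *\<^sub>R \<theta> + s *\<^sub>R x"
    have "z - \<theta> = s *\<^sub>R (x - \<theta>)" by (simp add: z_def algebra_simps)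
    then have zR: "norm (z - \<theta>) = R" using s by (simp add: t_def)
    have "f z \<le> (1 - s) * f \<theta> + s * f x"
      using reg s unfolding z_def regular_def by (intro convex_onD[of UNIV]) auto
    then have "s * (f x - f \<theta>) \<ge> f z - f \<theta>" by (simp add: algebra_simps)
    moreover have "f z - f \<theta> \<ge> - G * R + \<rho> / 2 * R\<^sup>2" using near[of z] zR by simp
    moreover have "- G * R + \<rho> / 2 * R\<^sup>2 = s * (t * (\<rho> * R / 2 - G))"
      unfolding mult.assoc[of s t, symmetric] s(3) by (simp add: power2_eq_square algebra_simps)
    ultimately have "s * (t * (\<rho> * R / 2 - G)) \<le> s * (f x - f \<theta>)" by simp
    then have "t * (\<rho> * R / 2 - G) \<le> f x - f \<theta>" using s(1) by simp
    moreover have "t * (a - G) \<le> t * (\<rho> * R / 2 - G)"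
      using a by (intro mult_left_mono) (auto simp: t_def)
    moreover have "0 \<le> a\<^sup>2 / (2 * \<rho>)" using \<rho> by simp
    ultimately show ?thesis by (simp add: t_def mult.commute)
  qed
qed

lemma regular_upper_bound:
  assumes reg: "regular f \<theta> M \<rho> L" and M: "0 \<le> M" and G: "norm (grad f \<theta>) \<le> G"
    and x: "x \<in> ecball \<theta> M"
  shows "f x \<le> f \<theta> + G * norm (x - \<theta>) + L / 2 * (norm (x - \<theta>))\<^sup>2"
proof -
  have "(x - \<theta>) \<bullet> grad f \<theta> \<le> norm (x - \<theta>) * norm (grad f \<theta>)" by (rule norm_cauchy_schwarz)
  also have "\<dots> \<le> norm (x - \<theta>) * G" by (intro mult_left_mono G) auto
  finally show ?thesis
    using regular_taylor(2)[OF reg center_mem_ecball[OF M] x] by (simp add: mult.commute)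
qed

text \<open>Growth of \<open>f\<close> away from \<open>\<theta>\<close> and growth of the penalty
  away from \<open>\<beta>\<close>, both with slope \<open>b\<close>, combine by the triangle
  inequality. The free slope \<open>b\<close> trades linear growth against the quadratic
  deficit.\<close>

lemma regular_penalized_lower_bound:
  assumes reg: "regular f \<theta> M \<rho> L" and M: "ereal R \<le> M" and R: "0 < R" and \<rho>: "0 < \<rho>"
    and G: "norm (grad f \<theta>) \<le> G" and b: "0 \<le> b" "b \<le> lam" "2 * (b + G) \<le> \<rho> * R"
  shows "f \<theta> + b * norm (\<beta> - \<theta>) - (b + G)\<^sup>2 / (2 * \<rho>) \<le> f x + lam * norm (\<beta> - x)"
proof -
  have "f \<theta> + b * norm (x - \<theta>) - (b + G)\<^sup>2 / (2 * \<rho>) \<le> f x"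
    using regular_linear_lower_bound[OF reg M R \<rho> G b(3)] by simp
  moreover have "b * norm (\<beta> - \<theta>) \<le> b * norm (\<beta> - x) + b * norm (x - \<theta>)"
    using b(1) norm_triangle_ineq[of "\<beta> - x" "x - \<theta>"]
    by (simp add: mult_left_mono flip: distrib_left)
  moreover have "b * norm (\<beta> - x) \<le> lam * norm (\<beta> - x)" by (intro mult_right_mono b) auto
  ultimately show ?thesis by linarith
qed

text \<open>The linear lower bound with \<open>a = 2 * (lam + G)\<close> has a slope exceeding
  \<open>lam\<close> by \<open>lam + G\<close>. The excess can only be paid out of the deficit
  \<open>a\<^sup>2 / (2 * \<rho>)\<close>, which limits the distance.\<close>

lemma regular_slope_le_imp_near:
  assumes reg: "regular f \<theta> M \<rho> L" and M: "ereal R \<le> M" and R: "0 < R" and \<rho>: "0 < \<rho>"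
    and G: "norm (grad f \<theta>) \<le> G" and pos: "0 < lam + G" and lam: "4 * (lam + G) \<le> \<rho> * R"
    and le: "f x \<le> f \<theta> + lam * norm (x - \<theta>)"
  shows "norm (x - \<theta>) \<le> 2 * (lam + G) / \<rho>"
proof -
  let ?t = "norm (x - \<theta>)"
  have "f \<theta> + (2 * (lam + G) - G) * ?t - (2 * (lam + G))\<^sup>2 / (2 * \<rho>) \<le> f x"
    using lam by (intro regular_linear_lower_bound[OF reg M R \<rho> G]) simp
  then have "(lam + G) * ?t \<le> (2 * (lam + G))\<^sup>2 / (2 * \<rho>)" using le by (simp add: algebra_simps)
  also have "\<dots> = (lam + G) * (2 * (lam + G) / \<rho>)"
    using \<rho> by (simp add: field_simps power2_eq_square)
  finally show ?thesis using pos by (simp only: mult_le_cancel_left_pos)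
qed

text \<open>The penalty rises from its anchor with slope \<open>lam\<close> in every direction,
  strictly faster than the tangent of \<open>f\<close> at \<open>\<beta>\<close> can fall.\<close>

lemma minimizer_eq_anchor:
  assumes reg: "regular f \<theta> M \<rho> L" and g: "norm (grad f \<beta>) < lam"
    and le: "f x + lam * norm (\<beta> - x) \<le> f \<beta>"
  shows "x = \<beta>"
proof (rule ccontr)
  assume "x \<noteq> \<beta>"
  then have "norm (\<beta> - x) * norm (grad f \<beta>) < norm (\<beta> - x) * lam" using g by simp
  moreover have "\<bar>(x - \<beta>) \<bullet> grad f \<beta>\<bar> \<le> norm (\<beta> - x) * norm (grad f \<beta>)"
    using Cauchy_Schwarz_ineq2[of "x - \<beta>" "grad f \<beta>"] by (simp add: norm_minus_commute)
  ultimately show False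
    using regular_ge_tangent[OF reg, of \<beta> x] le by (simp add: mult.commute)
qed

section \<open>Standing assumptions, units of length and counting of tasks\<close>

text \<open>The assumption \<open>0 < m\<close> gives the lower bound on \<open>lam\<close> an index
  to speak about, whence \<open>lam_pos\<close>. The empty case is settled in the final
  theorem.\<close>

locale clustered_minimizer =
  fixes f :: "nat \<Rightarrow> 'a::euclidean_space \<Rightarrow> real"
    and m K :: nat and \<epsilon> \<delta> \<rho> L \<alpha> lam :: real and M :: ereal
    and \<beta>s \<theta>s :: "nat \<Rightarrow> 'a" and zs :: "nat \<Rightarrow> nat" and S :: "nat set"
    and \<Theta>h Bh :: "nat \<Rightarrow> 'a" and zh :: "nat \<Rightarrow> nat"
  assumes m_pos: "0 < m"
    and delta: "\<delta> \<ge> 0"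
    and rho: "0 < \<rho>" "\<rho> \<le> L"
    and K2: "K \<ge> 2"
    and alpha: "0 < \<alpha>" "\<alpha> \<le> 1"
    and zs_range: "\<forall>j\<in>{1..m}. zs j \<in> {1..K}"
    and S_sub: "S \<subseteq> {1..m}"
    and reg: "\<forall>j\<in>S. regular (f j) (\<theta>s j) M \<rho> L"
    and close: "\<forall>j\<in>S. norm (\<theta>s j - \<beta>s (zs j)) \<le> \<delta>"
    and Sc_card: "real (card ({1..m} - S)) \<le> \<epsilon> * real m"
    and eps_small: "\<epsilon> \<le> \<alpha> / (6 * (L / \<rho>) * real K ^ 2)"
    and T_large: "\<forall>k\<in>{1..K}. real (card {j\<in>{1..m}. zs j = k}) \<ge> 7 * \<alpha> * real m / (6 * real K)"
    and lam_lower: "\<forall>j\<in>{1..m}. 12 * (L / \<rho>) * real K / sqrt \<alpha> * norm (grad (f j) (\<theta>s j)) < lam"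
    and lam_upper_M: "ereal lam < ereal (\<rho> / 6) * M"
    and lam_upper_sep: "\<forall>k\<in>{1..K}. \<forall>l\<in>{1..K}. k \<noteq> l \<longrightarrow> lam < \<rho> / 6 * norm (\<beta>s k - \<beta>s l)"
    and hat_feas: "feasible_z m K \<alpha> zh"
    and hat_min: "\<forall>\<Theta> B z. feasible_z m K \<alpha> z \<longrightarrow>
                    objective m f lam \<Theta>h Bh zh \<le> objective m f lam \<Theta> B z"
begin

text \<open>An \<open>L\<close>-Lipschitz gradient changes by at most \<open>lam\<close> over the
  distance \<open>w\<close>, the unit for errors of centers. \<open>G\<close> is the gradient bound
  implied by the lower condition on \<open>lam\<close>, and \<open>A\<close> is the smallest
  admissible group size.\<close>

definition w :: real where "w = lam / L"
definition G :: real where "G = lam * sqrt \<alpha> / (12 * (L / \<rho>) * K)"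
definition A :: real where "A = \<alpha> * m / K"
definition out :: real where "out = real (card ({1..m} - S))"

text \<open>Unlike $T(k)$ in the statement, this collects only the good tasks of a cluster.\<close>

abbreviation T :: "nat \<Rightarrow> nat set" where "T k \<equiv> {i\<in>{1..m}. zs i = k} \<inter> S"

lemma L_pos: "0 < L" using rho by simp

lemma kappa_ge_1: "1 \<le> L / \<rho>" using rho by simp

lemma lam_pos: "0 < lam"
proof -
  have "0 \<le> 12 * (L / \<rho>) * real K / sqrt \<alpha> * norm (grad (f 1) (\<theta>s 1))"
    using rho alpha by simp
  also have "\<dots> < lam" using lam_lower m_pos by simp
  finally show ?thesis .
qed

lemma w_pos: "0 < w" and rho_w_le: "\<rho> * w \<le> lam"
proof -
  show "0 < w" using lam_pos L_pos by (simp add: w_def)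
  moreover have "lam = L * w" using L_pos by (simp add: w_def)
  ultimately show "\<rho> * w \<le> lam" using rho(2) mult_right_mono[of \<rho> L w] by simp
qed

lemma G_nonneg: "0 \<le> G"
  using lam_pos rho alpha by (simp add: G_def)

lemma grad_le_G: "norm (grad (f j) (\<theta>s j)) \<le> G" if "j \<in> S"
proof -
  have "12 * (L / \<rho>) * real K / sqrt \<alpha> * norm (grad (f j) (\<theta>s j)) < lam"
    using lam_lower that S_sub by blast
  then show ?thesis
    using rho alpha K2 L_pos by (simp add: G_def field_simps)
qed

lemma G_le: "G \<le> \<rho> * w / 24"
proof -
  have "lam * sqrt \<alpha> * 2 \<le> lam * 1 * K"
    using K2 alpha lam_pos by (intro mult_mono) auto
  then show ?thesis using rho L_pos K2 by (simp add: G_def w_def field_simps)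
qed

lemma G_le_lam: "G \<le> lam / 24"
  using G_le rho_w_le by simp

text \<open>Since \<open>M\<close> may be infinite, \<open>6 * lam / \<rho>\<close> serves as the
  finite radius in all later arguments.\<close>

lemma radius_le_M: "ereal (6 * lam / \<rho>) \<le> M" and M_nonneg: "0 \<le> M"
proof -
  show *: "ereal (6 * lam / \<rho>) \<le> M"
    using lam_upper_M rho by (cases M) (auto simp: field_simps)
  have "0 \<le> ereal (6 * lam / \<rho>)" using lam_pos rho by simp
  then show "0 \<le> M" using * by (rule order_trans)
qed

lemma mem_ecball_if_near: "norm (x - c) \<le> 6 * lam / \<rho> \<Longrightarrow> x \<in> ecball c M"
  unfolding mem_ecball_iff by (rule order_trans[OF _ radius_le_M]) simp

lemma w_le: "w \<le> lam / \<rho>"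
  using rho_w_le rho by (simp add: field_simps)

lemma A_pos: "0 < A" using m_pos alpha K2 by (simp add: A_def)

lemma out_nonneg: "0 \<le> out" by (simp add: out_def)

text \<open>The condition number stays in the denominator because it turns \<open>lam * out\<close>
  into at most \<open>A * \<rho> * w / 12\<close>, the unit in which the losses of good tasks are
  counted. One factor \<open>K\<close> goes into \<open>A\<close>, the other is used through
  \<open>K >= 2\<close>.\<close>

lemma out_le: "out \<le> A / (12 * (L / \<rho>))"
proof -
  have "out \<le> \<epsilon> * m" using Sc_card by (simp add: out_def)
  also have "\<dots> \<le> \<alpha> / (6 * (L / \<rho>) * real K ^ 2) * m" by (intro mult_right_mono eps_small) simp
  also have "\<dots> = A / (6 * (L / \<rho>) * K)"
    using rho L_pos K2 by (simp add: A_def power2_eq_square field_simps)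
  also have "\<dots> \<le> A / (6 * (L / \<rho>) * 2)"
    using A_pos rho L_pos K2 by (intro divide_left_mono mult_left_mono) auto
  finally show ?thesis by simp
qed

lemma out_le_A: "out \<le> A / 12"
proof -
  have "A / (12 * (L / \<rho>)) \<le> A / (12 * 1)"
    using A_pos kappa_ge_1 by (intro divide_left_mono mult_left_mono) auto
  then show ?thesis using out_le by linarith
qed

lemma finite_S: "finite S" using S_sub by (rule finite_subset) simp

lemma split_sum: "(\<Sum>j\<in>{1..m}. g j) = (\<Sum>j\<in>S. g j) + (\<Sum>j\<in>{1..m} - S. g j)" for g :: "nat \<Rightarrow> real"
  using sum.subset_diff[OF S_sub, of g] by simp

lemma card_le_inter_S_plus_out:
  assumes "C \<subseteq> {1..m}" shows "real (card C) \<le> real (card (C \<inter> S)) + out"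
proof -
  have "C \<subseteq> (C \<inter> S) \<union> ({1..m} - S)" using assms by blast
  then have "card C \<le> card ((C \<inter> S) \<union> ({1..m} - S))" by (intro card_mono) (auto simp: finite_S)
  also have "\<dots> \<le> card (C \<inter> S) + card ({1..m} - S)" by (rule card_Un_le)
  finally show ?thesis by (simp add: out_def)
qed

text \<open>The surplus factor 7/6 absorbs the outliers: the good tasks of a true cluster meet the
  size constraint on their own.\<close>

lemma card_T_ge: "A \<le> real (card (T k))" if "k \<in> {1..K}"
proof -
  have "7 / 6 * A \<le> real (card {i\<in>{1..m}. zs i = k})"
    using bspec[OF T_large that] by (simp add: A_def mult.assoc)
  also have "\<dots> \<le> real (card (T k)) + out" by (rule card_le_inter_S_plus_out) auto
  finally show ?thesis using out_le_A A_pos by simp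
qed

lemma card_group_ge: "11 / 12 * A \<le> real (card ({j\<in>{1..m}. zh j = k} \<inter> S))" if "k \<in> {1..K}"
proof -
  have "A \<le> real (card {i\<in>{1..m}. zh i = k})"
    using hat_feas that by (auto simp: A_def feasible_z_def)
  also have "\<dots> \<le> real (card ({j\<in>{1..m}. zh j = k} \<inter> S)) + out"
    by (rule card_le_inter_S_plus_out) auto
  finally show ?thesis using out_le_A by simp
qed

lemma zh_range: "j \<in> {1..m} \<Longrightarrow> zh j \<in> {1..K}"
  using hat_feas by (auto simp: feasible_z_def)

text \<open>Each class swallows the good part of a whole true cluster, which is large enough
  already; the labels of the outliers remain free.\<close>

lemma feasible_if_contains_T:
  assumes "\<And>j. j \<in> {1..m} \<Longrightarrow> z j \<in> {1..K}"
    and "\<And>k. k \<in> {1..K} \<Longrightarrow> \<exists>l\<in>{1..K}. \<forall>j\<in>S. zs j = l \<longrightarrow> z j = k"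
  shows "feasible_z m K \<alpha> z"
  unfolding feasible_z_def
proof (intro conjI ballI)
  fix k assume "k \<in> {1..K}"
  then obtain l where l: "l \<in> {1..K}" "\<forall>j\<in>S. zs j = l \<longrightarrow> z j = k" using assms(2) by blast
  have "A \<le> card (T l)" using card_T_ge l(1) by blast
  also have "card (T l) \<le> card {j\<in>{1..m}. z j = k}" using l(2) by (intro card_mono) auto
  finally show "\<alpha> * real m / real K \<le> real (card {j\<in>{1..m}. z j = k})" by (simp add: A_def)
qed (use assms(1) in auto)

section \<open>Optimality of the estimator\<close>

text \<open>Common form of all comparisons. Outliers keep their \<open>\<Theta>h j\<close>, so their
  arbitrary losses cancel and only the displacement of their centers is charged, by the triangle
  inequality.\<close>

lemma hat_compare:
  assumes "feasible_z m K \<alpha> z" and eq: "\<And>j. j \<in> {1..m} - S \<Longrightarrow> \<Theta> j = \<Theta>h j"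
  shows "(\<Sum>j\<in>S. f j (\<Theta>h j) + lam * norm (Bh (zh j) - \<Theta>h j))
    \<le> (\<Sum>j\<in>S. f j (\<Theta> j) + lam * norm (B (z j) - \<Theta> j))
      + lam * (\<Sum>j\<in>{1..m} - S. norm (B (z j) - Bh (zh j)))"
proof -
  have "(\<Sum>j\<in>{1..m} - S. f j (\<Theta> j) + lam * norm (B (z j) - \<Theta> j))
    \<le> (\<Sum>j\<in>{1..m} - S. (f j (\<Theta>h j) + lam * norm (Bh (zh j) - \<Theta>h j))
        + lam * norm (B (z j) - Bh (zh j)))"
  proof (rule sum_mono)
    fix j assume j: "j \<in> {1..m} - S"
    have "norm (B (z j) - \<Theta>h j) \<le> norm (Bh (zh j) - \<Theta>h j) + norm (B (z j) - Bh (zh j))"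
      using norm_triangle_ineq[of "Bh (zh j) - \<Theta>h j" "B (z j) - Bh (zh j)"] by simp
    then have "lam * norm (B (z j) - \<Theta>h j) \<le> lam * (norm (Bh (zh j) - \<Theta>h j) + norm (B (z j) - Bh (zh j)))"
      using lam_pos by (intro mult_left_mono) auto
    then show "f j (\<Theta> j) + lam * norm (B (z j) - \<Theta> j)
      \<le> (f j (\<Theta>h j) + lam * norm (Bh (zh j) - \<Theta>h j)) + lam * norm (B (z j) - Bh (zh j))"
      using eq[OF j] by (simp add: distrib_left)
  qed
  moreover have "objective m f lam \<Theta>h Bh zh \<le> objective m f lam \<Theta> B z"
    using hat_min assms(1) by blast
  ultimately show ?thesis
    unfolding objective_def split_sum sum.distrib sum_distrib_left by linarith
qed

lemma hat_minimizes_each: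
  assumes j: "j \<in> S"
  shows "f j (\<Theta>h j) + lam * norm (Bh (zh j) - \<Theta>h j) \<le> f j x + lam * norm (Bh (zh j) - x)"
proof -
  have "(\<Sum>i\<in>S. f i (\<Theta>h i) + lam * norm (Bh (zh i) - \<Theta>h i))
    \<le> (\<Sum>i\<in>S. f i ((\<Theta>h(j := x)) i) + lam * norm (Bh (zh i) - (\<Theta>h(j := x)) i))
      + lam * (\<Sum>i\<in>{1..m} - S. norm (Bh (zh i) - Bh (zh i)))"
    using hat_feas j by (intro hat_compare) auto
  moreover have "(\<Sum>i\<in>S - {j}. f i ((\<Theta>h(j := x)) i) + lam * norm (Bh (zh i) - (\<Theta>h(j := x)) i))
    = (\<Sum>i\<in>S - {j}. f i (\<Theta>h i) + lam * norm (Bh (zh i) - \<Theta>h i))"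
    by (rule sum.cong) auto
  ultimately show ?thesis unfolding sum.remove[OF finite_S j] by simp
qed

text \<open>The penalty is \<open>lam\<close>-Lipschitz in the parameter, so \<open>f j\<close>
  rises from \<open>\<theta>s j\<close> to \<open>\<Theta>h j\<close> with average slope at most
  \<open>lam\<close>. With \<open>G_le_lam\<close> the radius is 25/12 times
  \<open>lam / \<rho>\<close>, below 11/5. No bound on \<open>\<delta>\<close> enters.\<close>

lemma hat_near:
  assumes j: "j \<in> S" shows "norm (\<Theta>h j - \<theta>s j) \<le> 11 * lam / (5 * \<rho>)"
proof -
  have r: "regular (f j) (\<theta>s j) M \<rho> L" using reg j by blast
  have "lam * norm (Bh (zh j) - \<theta>s j) \<le> lam * (norm (Bh (zh j) - \<Theta>h j) + norm (\<Theta>h j - \<theta>s j))"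
    using lam_pos norm_triangle_ineq[of "Bh (zh j) - \<Theta>h j" "\<Theta>h j - \<theta>s j"]
    by (intro mult_left_mono) auto
  then have "f j (\<Theta>h j) \<le> f j (\<theta>s j) + lam * norm (\<Theta>h j - \<theta>s j)"
    using hat_minimizes_each[OF j, of "\<theta>s j"] by (simp add: distrib_left)
  then have "norm (\<Theta>h j - \<theta>s j) \<le> 2 * (lam + G) / \<rho>"
    using rho lam_pos G_nonneg G_le_lam
    by (intro regular_slope_le_imp_near[OF r radius_le_M _ rho(1) grad_le_G[OF j]]) auto
  also have "\<dots> \<le> 2 * (lam + lam / 24) / \<rho>"
    using rho G_le_lam by (intro divide_right_mono) auto
  also have "\<dots> \<le> 11 * lam / (5 * \<rho>)" using rho lam_pos by (simp add: field_simps)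
  finally show ?thesis .
qed

text \<open>Both sides of the conclusion agree when \<open>\<delta>\<close> equals the left side of
  the assumption, and the right side grows with \<open>\<delta>\<close>.\<close>

lemma min_eq_if_delta_large:
  assumes "sqrt \<alpha> * lam / (25 * (L / \<rho>) * K * L) \<le> \<delta>"
  shows "11 * lam / (5 * \<rho>) \<le> 55 * (L / \<rho>)\<^sup>2 * K * \<delta> / sqrt \<alpha>"
proof -
  have "11 * lam / (5 * \<rho>) = 55 * (L / \<rho>)\<^sup>2 * K * (sqrt \<alpha> * lam / (25 * (L / \<rho>) * K * L)) / sqrt \<alpha>"
    using rho L_pos alpha K2 by (simp add: field_simps power2_eq_square)
  also have "\<dots> \<le> 55 * (L / \<rho>)\<^sup>2 * K * \<delta> / sqrt \<alpha>"
    using assms alpha by (intro divide_right_mono mult_left_mono) auto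
  finally show ?thesis .
qed

end

section \<open>The regime of small \<delta>: the basic inequality\<close>

text \<open>The threshold is the value of \<open>\<delta>\<close> at which the two terms of the minimum in the error
  bound coincide; recovery holds up to there, not only up to the smaller bound of the theorem.\<close>
locale clustered_minimizer_close = clustered_minimizer +
  assumes delta_small: "\<delta> \<le> sqrt \<alpha> * lam / (25 * (L / \<rho>) * K * L)"
begin

lemma delta_le: "\<delta> \<le> w / 50"
proof -
  have "sqrt \<alpha> * lam / (25 * (L / \<rho>) * K * L) \<le> 1 * lam / (25 * 1 * 2 * L)"
    using alpha lam_pos L_pos rho kappa_ge_1 K2 by (intro frac_le mult_mono) auto
  then show ?thesis using delta_small by (simp add: w_def)
qed

text \<open>Per good task, \<open>G\<^sup>2 / (2 * \<rho>)\<close> is the deficit of the lower bound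
  with slope 0, and the rest is the cost of sitting at the true center. \<open>G\<close> and the
  bound on \<open>\<delta>\<close> carry the factor \<open>q\<close>, whose square contains
  \<open>\<alpha> / K\<^sup>2\<close>; hence the sum over up to \<open>m = A * K / \<alpha>\<close>
  tasks is of order \<open>A / K\<close>.\<close>

lemma slack_le: "real (card S) * (G\<^sup>2 / (2 * \<rho>) + (G * \<delta> + L / 2 * \<delta>\<^sup>2)) \<le> A * \<rho> * w\<^sup>2 / 250"
proof -
  define q where "q = sqrt \<alpha> / ((L / \<rho>) * K)"
  have q: "0 < q" using alpha rho L_pos K2 by (simp add: q_def)
  define X where "X = lam\<^sup>2 * q\<^sup>2 / \<rho>"
  have X0: "0 \<le> X" using rho by (simp add: X_def)
  have G: "G = lam * q / 12" by (simp add: G_def q_def)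
  have d: "\<delta> \<le> lam * q / (25 * L)" using delta_small by (simp add: q_def mult.commute mult.left_commute)
  have X_ge: "lam\<^sup>2 * q\<^sup>2 / L \<le> X" unfolding X_def using rho by (intro divide_left_mono) auto
  have "G\<^sup>2 / (2 * \<rho>) = X / 288" by (simp add: G X_def power_mult_distrib power_divide)
  moreover have "G * \<delta> \<le> X / 300"
  proof -
    have "G * \<delta> \<le> (lam * q / 12) * (lam * q / (25 * L))"
      unfolding G using d lam_pos q by (intro mult_left_mono) auto
    also have "\<dots> = (lam\<^sup>2 * q\<^sup>2 / L) / 300" by (simp add: power2_eq_square mult_ac)
    also have "\<dots> \<le> X / 300" using X_ge by (intro divide_right_mono) auto
    finally show ?thesis .
  qed
  moreover have "L / 2 * \<delta>\<^sup>2 \<le> X / 1250"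
  proof -
    have "L / 2 * \<delta>\<^sup>2 \<le> L / 2 * (lam * q / (25 * L))\<^sup>2"
      using d delta L_pos by (intro mult_left_mono power_mono) auto
    also have "\<dots> = (lam\<^sup>2 * q\<^sup>2 / L) / 1250" using L_pos by (simp add: power2_eq_square mult_ac)
    also have "\<dots> \<le> X / 1250" using X_ge by (intro divide_right_mono) auto
    finally show ?thesis .
  qed
  ultimately have "G\<^sup>2 / (2 * \<rho>) + (G * \<delta> + L / 2 * \<delta>\<^sup>2) \<le> X / 125" using X0 by linarith
  then have "real (card S) * (G\<^sup>2 / (2 * \<rho>) + (G * \<delta> + L / 2 * \<delta>\<^sup>2)) \<le> real m * (X / 125)"
    using card_mono[OF _ S_sub] delta G_nonneg L_pos rho by (intro mult_mono) auto
  also have "real m * (X / 125) = A * \<rho> * w\<^sup>2 * (1 / (125 * K))"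
  proof -
    have "q\<^sup>2 = \<alpha> * \<rho>\<^sup>2 / (L\<^sup>2 * (real K)\<^sup>2)"
      using alpha by (simp add: q_def power_divide power_mult_distrib)
    then show ?thesis using rho L_pos K2 by (simp add: X_def A_def w_def power2_eq_square field_simps)
  qed
  also have "\<dots> \<le> A * \<rho> * w\<^sup>2 * (1 / 250)"
    using K2 A_pos rho by (intro mult_left_mono) (auto simp: field_simps)
  finally show ?thesis by simp
qed

lemma penalized_ge:
  assumes j: "j \<in> S" and b: "0 \<le> b" "b \<le> lam"
  shows "f j (\<theta>s j) + b * norm (\<beta> - \<theta>s j) - (b + G)\<^sup>2 / (2 * \<rho>) \<le> f j x + lam * norm (\<beta> - x)"
  by (rule regular_penalized_lower_bound[OF _ radius_le_M _ rho(1) grad_le_G[OF j]])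
     (use reg j b rho lam_pos G_le_lam in auto)

lemma value_le:
  assumes j: "j \<in> S" and r: "norm (x - \<theta>s j) \<le> r" "r \<le> 6 * lam / \<rho>"
  shows "f j x \<le> f j (\<theta>s j) + (G * r + L / 2 * r\<^sup>2)"
proof -
  have "f j x \<le> f j (\<theta>s j) + G * norm (x - \<theta>s j) + L / 2 * (norm (x - \<theta>s j))\<^sup>2"
    using reg j r by (intro regular_upper_bound[OF _ M_nonneg grad_le_G[OF j]] mem_ecball_if_near) auto
  moreover have "G * norm (x - \<theta>s j) \<le> G * r" using G_nonneg r by (intro mult_left_mono) auto
  moreover have "L / 2 * (norm (x - \<theta>s j))\<^sup>2 \<le> L / 2 * r\<^sup>2"
    using L_pos r by (intro mult_left_mono power_mono) auto
  ultimately show ?thesis by linarith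
qed

text \<open>The competitor uses the true centers; its outliers follow their estimated center to the true
  center assigned to it by \<open>\<sigma>\<close>, so that they cost at most \<open>lam * s\<close> each.\<close>
lemma basic_inequality:
  assumes \<sigma>: "\<And>k. k \<in> {1..K} \<Longrightarrow> \<sigma> k \<in> {1..K}"
    and s: "\<And>k. k \<in> {1..K} \<Longrightarrow> norm (Bh k - \<beta>s (\<sigma> k)) \<le> s"
    and C: "C \<subseteq> S" and b: "0 \<le> b" "b \<le> lam"
  shows "(\<Sum>j\<in>C. b * norm (Bh (zh j) - \<theta>s j) - (b + G)\<^sup>2 / (2 * \<rho>))
    \<le> lam * out * s + A * \<rho> * w\<^sup>2 / 250"
proof -
  let ?z = "\<lambda>j. if j \<in> S then zs j else \<sigma> (zh j)"
  let ?\<Theta> = "\<lambda>j. if j \<in> S then \<beta>s (zs j) else \<Theta>h j"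
  let ?h = "\<lambda>j. f j (\<Theta>h j) + lam * norm (Bh (zh j) - \<Theta>h j)"
  let ?c = "G * \<delta> + L / 2 * \<delta>\<^sup>2"
  have fin: "finite C" using C finite_S by (rule finite_subset)
  have "feasible_z m K \<alpha> ?z"
    using zs_range \<sigma> zh_range by (intro feasible_if_contains_T) auto
  then have "(\<Sum>j\<in>S. ?h j) \<le> (\<Sum>j\<in>S. f j (?\<Theta> j) + lam * norm (\<beta>s (?z j) - ?\<Theta> j))
      + lam * (\<Sum>j\<in>{1..m} - S. norm (\<beta>s (?z j) - Bh (zh j)))"
    by (rule hat_compare) auto
  also have "(\<Sum>j\<in>S. f j (?\<Theta> j) + lam * norm (\<beta>s (?z j) - ?\<Theta> j)) \<le> (\<Sum>j\<in>S. f j (\<theta>s j) + ?c)"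
  proof (rule sum_mono)
    fix j assume j: "j \<in> S"
    have "0 < lam / \<rho>" using lam_pos rho by simp
    then have "\<delta> \<le> 6 * (lam / \<rho>)" using delta_le w_le by linarith
    then have "f j (\<beta>s (zs j)) \<le> f j (\<theta>s j) + ?c"
      using close j by (intro value_le) (auto simp: norm_minus_commute)
    then show "f j (?\<Theta> j) + lam * norm (\<beta>s (?z j) - ?\<Theta> j) \<le> f j (\<theta>s j) + ?c" using j by simp
  qed
  also have "lam * (\<Sum>j\<in>{1..m} - S. norm (\<beta>s (?z j) - Bh (zh j))) \<le> lam * (\<Sum>j\<in>{1..m} - S. s)"
    using lam_pos s zh_range by (intro mult_left_mono sum_mono) (auto simp: norm_minus_commute)
  also have "(\<Sum>j\<in>S. f j (\<theta>s j) + ?c) = (\<Sum>j\<in>S. f j (\<theta>s j)) + real (card S) * ?c"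
    by (simp add: sum.distrib)
  also have "lam * (\<Sum>j\<in>{1..m} - S. s) = lam * out * s" by (simp add: out_def)
  finally have up: "(\<Sum>j\<in>S. ?h j) \<le> (\<Sum>j\<in>S. f j (\<theta>s j)) + real (card S) * ?c + lam * out * s"
    by linarith
  have "(\<Sum>j\<in>C. b * norm (Bh (zh j) - \<theta>s j) - (b + G)\<^sup>2 / (2 * \<rho>)) \<le> (\<Sum>j\<in>C. ?h j - f j (\<theta>s j))"
    using penalized_ge[OF _ b] C by (intro sum_mono) (auto simp: algebra_simps subset_iff)
  \<comment> \<open>Slope 0 suffices outside \<open>C\<close>: such a task undercuts its value at
    \<open>\<theta>s j\<close> by at most \<open>G\<^sup>2 / (2 * \<rho>)\<close>.\<close>
  moreover have "(\<Sum>j\<in>S - C. - (G\<^sup>2 / (2 * \<rho>))) \<le> (\<Sum>j\<in>S - C. ?h j - f j (\<theta>s j))"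
    using penalized_ge[of _ 0] lam_pos by (intro sum_mono) (auto simp: algebra_simps)
  moreover have "(\<Sum>j\<in>S - C. - (G\<^sup>2 / (2 * \<rho>))) = - (real (card (S - C)) * (G\<^sup>2 / (2 * \<rho>)))"
    by simp
  moreover have "(\<Sum>j\<in>S. ?h j - f j (\<theta>s j)) = (\<Sum>j\<in>S. ?h j) - (\<Sum>j\<in>S. f j (\<theta>s j))"
    by (rule sum_subtractf)
  moreover have "(\<Sum>j\<in>S. ?h j - f j (\<theta>s j)) = (\<Sum>j\<in>S - C. ?h j - f j (\<theta>s j)) + (\<Sum>j\<in>C. ?h j - f j (\<theta>s j))"
    by (rule sum.subset_diff[OF C finite_S])
  moreover have "real (card (S - C)) * (G\<^sup>2 / (2 * \<rho>)) \<le> real (card S) * (G\<^sup>2 / (2 * \<rho>))"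
    using finite_S rho by (intro mult_right_mono) (auto intro: card_mono)
  moreover have "real (card S) * (G\<^sup>2 / (2 * \<rho>)) + real (card S) * ?c \<le> A * \<rho> * w\<^sup>2 / 250"
    using slack_le by (simp only: distrib_left)
  ultimately show ?thesis using up by linarith
qed

lemma unit_pos: "0 < lam / \<rho>"
  using lam_pos rho by simp

section \<open>Location of the estimated centers\<close>

lemma estimated_centers_near:
  "\<exists>\<sigma>. \<forall>k\<in>{1..K}. \<sigma> k \<in> {1..K} \<and> norm (Bh k - \<beta>s (\<sigma> k)) \<le> 7 / 20 * w"
proof -
  have ne: "{1..K} \<noteq> {}" using K2 by simp
  have "\<exists>l. l \<in> {1..K} \<and> (\<forall>l'\<in>{1..K}. norm (Bh k - \<beta>s l) \<le> norm (Bh k - \<beta>s l'))" for k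
  proof -
    let ?D = "(\<lambda>l. norm (Bh k - \<beta>s l)) ` {1..K}"
    have "Min ?D \<in> ?D" using ne by (intro Min_in) auto
    then obtain l where "l \<in> {1..K}" "norm (Bh k - \<beta>s l) = Min ?D" by auto
    then show ?thesis by (intro exI[of _ l]) auto
  qed
  then have "\<exists>\<sigma>. \<forall>k. \<sigma> k \<in> {1..K} \<and> (\<forall>l'\<in>{1..K}. norm (Bh k - \<beta>s (\<sigma> k)) \<le> norm (Bh k - \<beta>s l'))"
    by (intro choice allI)
  then obtain \<sigma> where \<sigma>: "\<And>k. \<sigma> k \<in> {1..K}"
    "\<And>k l. l \<in> {1..K} \<Longrightarrow> norm (Bh k - \<beta>s (\<sigma> k)) \<le> norm (Bh k - \<beta>s l)"
    by blast
  let ?D = "(\<lambda>k. norm (Bh k - \<beta>s (\<sigma> k))) ` {1..K}"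
  define s where "s = Max ?D"
  have "s \<in> ?D" unfolding s_def using ne by (intro Max_in) auto
  then obtain k0 where k0: "k0 \<in> {1..K}" "norm (Bh k0 - \<beta>s (\<sigma> k0)) = s" by auto
  have s_ge: "norm (Bh k - \<beta>s (\<sigma> k)) \<le> s" if "k \<in> {1..K}" for k
    unfolding s_def using that by (intro Max_ge) auto
  have "s \<le> 7 / 20 * w"
  proof (rule ccontr)
    assume "\<not> ?thesis"
    then have s: "7 / 20 * w < s" by simp
    let ?C = "{j\<in>{1..m}. zh j = k0} \<inter> S"
    \<comment> \<open>This small slope keeps the quadratic deficit of order
      \<open>\<rho> * w\<^sup>2\<close>; with slope \<open>lam\<close> it would be of order
      \<open>lam\<^sup>2 / \<rho>\<close>. The good tasks then pay about 11/48 of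
      \<open>A * \<rho> * w * s\<close>, the outliers recover at most 1/12 of it.\<close>
    let ?b = "\<rho> * w / 4"
    \<comment> \<open>\<open>43 / 900\<close> exceeds \<open>1 / 200 + 49 / 1152\<close>, the losses from \<open>\<delta>\<close> and from the quadratic term.\<close>
    define v where "v = s / 4 - 43 / 900 * w"
    have v: "0 < v" using s w_pos by (simp add: v_def)
    have "(?b + G)\<^sup>2 \<le> (7 / 24 * (\<rho> * w))\<^sup>2"
      using G_le G_nonneg rho w_pos by (intro power_mono) auto
    then have "(?b + G)\<^sup>2 / (2 * \<rho>) \<le> (7 / 24 * (\<rho> * w))\<^sup>2 / (2 * \<rho>)"
      using rho by (intro divide_right_mono) auto
    also have "\<dots> = \<rho> * w * (49 / 1152 * w)" using rho by (simp add: power2_eq_square)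
    finally have quad: "(?b + G)\<^sup>2 / (2 * \<rho>) \<le> \<rho> * w * (49 / 1152 * w)" .
    have "\<rho> * w * v \<le> ?b * norm (Bh (zh j) - \<theta>s j) - (?b + G)\<^sup>2 / (2 * \<rho>)" if j: "j \<in> ?C" for j
    proof -
      \<comment> \<open>\<open>\<sigma> k0\<close> is a nearest true center, so the true center of
        any task in the group is at least as far from \<open>Bh k0\<close>.\<close>
      have "s \<le> norm (Bh k0 - \<beta>s (zs j))" using \<sigma>(2)[of "zs j" k0] k0 zs_range j by auto
      also have "\<dots> \<le> norm (Bh k0 - \<theta>s j) + norm (\<theta>s j - \<beta>s (zs j))"
        using norm_triangle_ineq[of "Bh k0 - \<theta>s j" "\<theta>s j - \<beta>s (zs j)"] by simp
      finally have "s - w / 50 \<le> norm (Bh (zh j) - \<theta>s j)" using close j delta_le by force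
      then have "?b * (s - w / 50) \<le> ?b * norm (Bh (zh j) - \<theta>s j)"
        using rho w_pos by (intro mult_left_mono) auto
      moreover have "?b * (s - w / 50) = \<rho> * w * (s / 4 - w / 200)" by (simp add: algebra_simps)
      moreover have "\<rho> * w * v \<le> \<rho> * w * (s / 4 - w / 200 - 49 / 1152 * w)"
        using rho w_pos by (intro mult_left_mono) (auto simp: v_def)
      ultimately show ?thesis using quad by (simp add: right_diff_distrib)
    qed
    then have "real (card ?C) * (\<rho> * w * v)
      \<le> (\<Sum>j\<in>?C. ?b * norm (Bh (zh j) - \<theta>s j) - (?b + G)\<^sup>2 / (2 * \<rho>))"
      by (intro sum_bounded_below) auto
    also have "\<dots> \<le> lam * out * s + A * \<rho> * w\<^sup>2 / 250"
    proof (rule basic_inequality[where \<sigma> = \<sigma>])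
      have "0 < \<rho> * w" using rho w_pos by simp
      then show "0 \<le> \<rho> * w / 4" "\<rho> * w / 4 \<le> lam" using rho_w_le by linarith+
    qed (use \<sigma>(1) s_ge in auto)
    also have "lam * out * s \<le> lam * (A / (12 * (L / \<rho>))) * s"
      using out_le lam_pos s w_pos by (intro mult_right_mono mult_left_mono) auto
    also have "lam * (A / (12 * (L / \<rho>))) * s = A * \<rho> * w * (s / 12)"
      using L_pos rho by (simp add: w_def mult_ac)
    also have "A * \<rho> * w * (s / 12) + A * \<rho> * w\<^sup>2 / 250 = A * \<rho> * w * (s / 12 + w / 250)"
      by (simp add: power2_eq_square algebra_simps)
    finally have "real (card ?C) * (\<rho> * w * v) \<le> A * \<rho> * w * (s / 12 + w / 250)"
      by simp
    moreover have "11 / 12 * A * (\<rho> * w * v) \<le> real (card ?C) * (\<rho> * w * v)"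
      using card_group_ge[OF k0(1)] rho w_pos v by (intro mult_right_mono) auto
    moreover have "11 / 12 * A * (\<rho> * w * v) = A * \<rho> * w * (11 / 12 * v)" by simp
    ultimately have "A * \<rho> * w * (11 / 12 * v) \<le> A * \<rho> * w * (s / 12 + w / 250)" by linarith
    then have "11 / 12 * v \<le> s / 12 + w / 250"
      using A_pos rho w_pos by (simp only: mult_le_cancel_left_pos mult_pos_pos)
    \<comment> \<open>Collecting the terms in \<open>s\<close> gives \<open>s <= 0.33 * w\<close>,
      against the assumed \<open>7 / 20 * w < s\<close>.\<close>
    then show False using s w_pos by (simp add: v_def)
  qed
  then show ?thesis
    by (intro exI[of _ \<sigma>] ballI conjI \<sigma>(1) order_trans[OF s_ge])
qed

text \<open>True centers are more than \<open>6 * lam / \<rho>\<close> apart, and the two errors use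
  up at most \<open>0.37 * w\<close>. At the remaining distance the full slope \<open>lam\<close>
  pays off: at least 5.6 units of \<open>lam\<^sup>2 / \<rho>\<close>, against a deficit of about
  0.54.\<close>

lemma wrong_center_far:
  assumes j: "j \<in> S" and k: "k \<in> {1..K}" "k \<noteq> zs j" and near: "norm (b - \<beta>s k) \<le> 7 / 20 * w"
  shows "5 * lam\<^sup>2 / \<rho> \<le> lam * norm (b - \<theta>s j) - (lam + G)\<^sup>2 / (2 * \<rho>)"
proof -
  have "zs j \<in> {1..K}" using zs_range j S_sub by blast
  then have "lam < \<rho> / 6 * norm (\<beta>s k - \<beta>s (zs j))" using lam_upper_sep k by blast
  then have "6 * (lam / \<rho>) < norm (\<beta>s k - \<beta>s (zs j))" using rho by (simp add: field_simps)
  moreover have "norm (\<beta>s k - \<beta>s (zs j)) \<le> norm (b - \<beta>s k) + norm (b - \<theta>s j) + norm (\<theta>s j - \<beta>s (zs j))"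
    using norm_triangle_ineq[of "\<beta>s k - b" "b - \<theta>s j"]
      norm_triangle_ineq[of "\<beta>s k - \<theta>s j" "\<theta>s j - \<beta>s (zs j)"]
    by (simp add: norm_minus_commute)
  moreover have "norm (\<theta>s j - \<beta>s (zs j)) \<le> w / 50" using bspec[OF close j] delta_le by simp
  ultimately have "56 / 10 * (lam / \<rho>) \<le> norm (b - \<theta>s j)" using near w_le unit_pos by linarith
  then have "lam * (56 / 10 * (lam / \<rho>)) \<le> lam * norm (b - \<theta>s j)"
    using lam_pos by (intro mult_left_mono) auto
  moreover have "(lam + G)\<^sup>2 / (2 * \<rho>) \<le> (25 / 24 * lam)\<^sup>2 / (2 * \<rho>)"
    using G_le_lam G_nonneg lam_pos rho by (intro divide_right_mono power_mono) auto
  moreover have "(25 / 24 * lam)\<^sup>2 / (2 * \<rho>) = 625 / 1152 * (lam\<^sup>2 / \<rho>)"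
    by (simp add: power2_eq_square)
  moreover have "lam * (56 / 10 * (lam / \<rho>)) = 56 / 10 * (lam\<^sup>2 / \<rho>)"
    by (simp add: power2_eq_square)
  moreover have "0 \<le> lam\<^sup>2 / \<rho>" using rho by simp
  moreover have "5 * lam\<^sup>2 / \<rho> = 5 * (lam\<^sup>2 / \<rho>)" by simp
  ultimately show ?thesis by linarith
qed

text \<open>If no estimated center were near \<open>\<beta>s l\<close>, all good tasks of that
  cluster would sit at wrong centers and pay \<open>5 * A * lam\<^sup>2 / \<rho>\<close> in total,
  far above the budget of \<open>basic_inequality\<close>. A surjection of a finite set onto itself
  is bijective.\<close>

lemma nearest_centers_bij:
  assumes \<sigma>: "\<And>k. k \<in> {1..K} \<Longrightarrow> \<sigma> k \<in> {1..K}"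
    and near: "\<And>k. k \<in> {1..K} \<Longrightarrow> norm (Bh k - \<beta>s (\<sigma> k)) \<le> 7 / 20 * w"
  shows "bij_betw \<sigma> {1..K} {1..K}"
proof -
  have "l \<in> \<sigma> ` {1..K}" if l: "l \<in> {1..K}" for l
  proof (rule ccontr)
    assume l': "l \<notin> \<sigma> ` {1..K}"
    define Y where "Y = A * (lam\<^sup>2 / \<rho>)"
    have Y: "0 < Y" using A_pos rho lam_pos by (simp add: Y_def)
    have "5 * lam\<^sup>2 / \<rho> \<le> lam * norm (Bh (zh j) - \<theta>s j) - (lam + G)\<^sup>2 / (2 * \<rho>)" if j: "j \<in> T l" for j
    proof -
      have zh: "zh j \<in> {1..K}" using j zh_range by blast
      moreover have "zs j \<notin> \<sigma> ` {1..K}" using j l' by simp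
      ultimately have "\<sigma> (zh j) \<noteq> zs j" by (metis imageI)
      then show ?thesis
        using wrong_center_far[OF _ \<sigma>[OF zh] _ near[OF zh], of j] j by blast
    qed
    then have "real (card (T l)) * (5 * lam\<^sup>2 / \<rho>)
      \<le> (\<Sum>j\<in>T l. lam * norm (Bh (zh j) - \<theta>s j) - (lam + G)\<^sup>2 / (2 * \<rho>))"
      by (intro sum_bounded_below) auto
    also have "\<dots> \<le> lam * out * (7 / 20 * w) + A * \<rho> * w\<^sup>2 / 250"
      by (rule basic_inequality[where \<sigma> = \<sigma>]) (use \<sigma> near lam_pos in auto)
    also have "lam * out * (7 / 20 * w) \<le> lam * (A / 12) * (7 / 20 * (lam / \<rho>))"
      using out_le_A lam_pos w_le w_pos A_pos out_nonneg by (intro mult_mono) auto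
    also have "lam * (A / 12) * (7 / 20 * (lam / \<rho>)) = 7 / 240 * Y"
      by (simp add: Y_def power2_eq_square)
    also have "A * \<rho> * w\<^sup>2 / 250 \<le> A * \<rho> * (lam / \<rho>)\<^sup>2 / 250"
      using w_le w_pos A_pos rho by (intro divide_right_mono mult_left_mono power_mono) auto
    also have "A * \<rho> * (lam / \<rho>)\<^sup>2 / 250 = 1 / 250 * Y"
      using rho by (simp add: Y_def power2_eq_square)
    finally have "real (card (T l)) * (5 * lam\<^sup>2 / \<rho>) \<le> 7 / 240 * Y + 1 / 250 * Y" by simp
    moreover have "A * (5 * lam\<^sup>2 / \<rho>) \<le> real (card (T l)) * (5 * lam\<^sup>2 / \<rho>)"
      using card_T_ge[OF l] rho by (intro mult_right_mono) auto
    moreover have "A * (5 * lam\<^sup>2 / \<rho>) = 5 * Y" by (simp add: Y_def)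
    ultimately show False using Y by linarith
  qed
  then have "\<sigma> ` {1..K} = {1..K}" using \<sigma> by blast
  then show ?thesis by (simp add: bij_betw_def eq_card_imp_inj_on)
qed

lemma right_center_near:
  assumes j: "j \<in> S" and near: "norm (b - \<beta>s (zs j)) \<le> 7 / 20 * w"
  shows "norm (b - \<theta>s j) \<le> 2 / 5 * w"
proof -
  have "norm (b - \<theta>s j) \<le> norm (b - \<beta>s (zs j)) + norm (\<theta>s j - \<beta>s (zs j))"
    using norm_triangle_ineq[of "b - \<beta>s (zs j)" "\<beta>s (zs j) - \<theta>s j"] by (simp add: norm_minus_commute)
  also have "\<dots> \<le> 7 / 20 * w + w / 50" using near bspec[OF close j] delta_le by simp
  finally show ?thesis using w_pos by linarith
qed

section \<open>Recovery of labels and collapse onto the centers\<close>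

text \<open>\<open>\<tau>\<close> inverts the assignment of estimated to true centers. The
  competitor moves each mislabelled good task, parameter included, onto the estimated center of its
  true cluster and leaves everything else unchanged.\<close>

lemma labels_recovered:
  "\<exists>\<tau>. bij_betw \<tau> {1..K} {1..K} \<and>
    (\<forall>j\<in>S. zh j = \<tau> (zs j) \<and> norm (Bh (zh j) - \<beta>s (zs j)) \<le> 7 / 20 * w)"
proof -
  from estimated_centers_near obtain \<sigma>
    where "\<forall>k\<in>{1..K}. \<sigma> k \<in> {1..K} \<and> norm (Bh k - \<beta>s (\<sigma> k)) \<le> 7 / 20 * w" ..
  then have \<sigma>: "\<sigma> k \<in> {1..K}" "norm (Bh k - \<beta>s (\<sigma> k)) \<le> 7 / 20 * w" if "k \<in> {1..K}" for k
    using that by blast+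
  define \<tau> where "\<tau> = inv_into {1..K} \<sigma>"
  have bij\<sigma>: "bij_betw \<sigma> {1..K} {1..K}" by (rule nearest_centers_bij) (fact \<sigma>)+
  then have bij: "bij_betw \<tau> {1..K} {1..K}" unfolding \<tau>_def by (rule bij_betw_inv_into)
  have \<sigma>\<tau>: "\<sigma> (\<tau> l) = l" if "l \<in> {1..K}" for l
    using bij_betw_inv_into_right[OF bij\<sigma> that] by (simp add: \<tau>_def)
  have \<tau>\<sigma>: "\<tau> (\<sigma> k) = k" if "k \<in> {1..K}" for k
    using bij_betw_inv_into_left[OF bij\<sigma> that] by (simp add: \<tau>_def)
  have \<tau>: "\<tau> l \<in> {1..K}" if "l \<in> {1..K}" for l
    using bij_betw_apply[OF bij that] .
  have zs: "zs j \<in> {1..K}" if "j \<in> S" for j using that zs_range S_sub by blast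
  have near: "norm (Bh (\<tau> (zs j)) - \<beta>s (zs j)) \<le> 7 / 20 * w" if "j \<in> S" for j
    using \<sigma>(2)[OF \<tau>[OF zs[OF that]]] \<sigma>\<tau>[OF zs[OF that]] by simp
  let ?z = "\<lambda>j. if j \<in> S then \<tau> (zs j) else zh j"
  let ?\<Theta> = "\<lambda>j. if j \<in> S \<and> zh j \<noteq> \<tau> (zs j) then Bh (\<tau> (zs j)) else \<Theta>h j"
  let ?h = "\<lambda>j. f j (\<Theta>h j) + lam * norm (Bh (zh j) - \<Theta>h j)"
  let ?h' = "\<lambda>j. f j (?\<Theta> j) + lam * norm (Bh (?z j) - ?\<Theta> j)"
  \<comment> \<open>In units of \<open>lam\<^sup>2 / \<rho>\<close>, measured from
    \<open>f j (\<theta>s j)\<close>: a wrong center costs at least 5, the right one at most 2/5 +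
    2/25.\<close>
  have less: "?h' j < ?h j" if j: "j \<in> S" and ne: "zh j \<noteq> \<tau> (zs j)" for j
  proof -
    have zh: "zh j \<in> {1..K}" using j S_sub zh_range by blast
    have "\<sigma> (zh j) \<noteq> zs j"
    proof
      assume "\<sigma> (zh j) = zs j"
      then show False using \<tau>\<sigma>[OF zh] ne by simp
    qed
    then have "5 * lam\<^sup>2 / \<rho> \<le> lam * norm (Bh (zh j) - \<theta>s j) - (lam + G)\<^sup>2 / (2 * \<rho>)"
      by (rule wrong_center_far[OF j \<sigma>(1)[OF zh] _ \<sigma>(2)[OF zh]])
    then have "f j (\<theta>s j) + 5 * lam\<^sup>2 / \<rho> \<le> ?h j"
      using penalized_ge[OF j _ order_refl, of "Bh (zh j)" "\<Theta>h j"] lam_pos by linarith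
    moreover have "f j (Bh (\<tau> (zs j))) \<le> f j (\<theta>s j) + (G * (2 / 5 * w) + L / 2 * (2 / 5 * w)\<^sup>2)"
      using right_center_near[OF j near[OF j]] w_le unit_pos by (intro value_le[OF j]) auto
    moreover have "G * (2 / 5 * w) \<le> lam * (2 / 5 * (lam / \<rho>))"
      using G_le_lam G_nonneg lam_pos w_le w_pos by (intro mult_mono) auto
    moreover have "lam * (2 / 5 * (lam / \<rho>)) = 2 / 5 * (lam\<^sup>2 / \<rho>)"
      by (simp add: power2_eq_square)
    moreover have "lam * (2 / 25 * (lam / \<rho>)) = 2 / 25 * (lam\<^sup>2 / \<rho>)"
      by (simp add: power2_eq_square)
    moreover have "5 * lam\<^sup>2 / \<rho> = 5 * (lam\<^sup>2 / \<rho>)" by simp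
    moreover have "L / 2 * (2 / 5 * w)\<^sup>2 = lam * (2 / 25 * w)"
      using L_pos by (simp add: w_def power2_eq_square)
    moreover have "lam * (2 / 25 * w) \<le> lam * (2 / 25 * (lam / \<rho>))"
      using lam_pos w_le by (intro mult_left_mono) auto
    moreover have "0 < lam\<^sup>2 / \<rho>" using lam_pos rho by simp
    ultimately have "f j (Bh (\<tau> (zs j))) < ?h j" by linarith
    then show ?thesis using j ne by simp
  qed
  have labels: "zh j = \<tau> (zs j)" if j: "j \<in> S" for j
  proof (rule ccontr)
    assume ne: "zh j \<noteq> \<tau> (zs j)"
    have "feasible_z m K \<alpha> ?z"
    proof (rule feasible_if_contains_T)
      \<comment> \<open>Class \<open>k\<close> receives all good tasks of the true cluster
        \<open>\<sigma> k\<close>.\<close>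
      show "\<exists>l\<in>{1..K}. \<forall>j\<in>S. zs j = l \<longrightarrow> ?z j = k" if k: "k \<in> {1..K}" for k
        by (intro bexI[of _ "\<sigma> k"] \<sigma>(1)[OF k]) (simp add: \<tau>\<sigma>[OF k])
      show "?z j \<in> {1..K}" if "j \<in> {1..m}" for j
        using \<tau> zs zh_range[OF that] by simp
    qed
    then have "(\<Sum>j\<in>S. ?h j) \<le> (\<Sum>j\<in>S. ?h' j) + lam * (\<Sum>j\<in>{1..m} - S. norm (Bh (?z j) - Bh (zh j)))"
      by (rule hat_compare) auto
    moreover have "(\<Sum>j\<in>{1..m} - S. norm (Bh (?z j) - Bh (zh j))) = 0" by (rule sum.neutral) auto
    moreover have "(\<Sum>j\<in>S. ?h' j) < (\<Sum>j\<in>S. ?h j)"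
    proof (rule sum_strict_mono_ex1[OF finite_S])
      show "\<forall>j\<in>S. ?h' j \<le> ?h j"
      proof
        fix i assume "i \<in> S"
        then show "?h' i \<le> ?h i" using less[of i] by (cases "zh i = \<tau> (zs i)") auto
      qed
      show "\<exists>j\<in>S. ?h' j < ?h j" by (rule bexI[OF _ j]) (rule less[OF j ne])
    qed
    ultimately show False by simp
  qed
  show ?thesis
  proof (intro exI conjI ballI)
    fix j assume "j \<in> S"
    then show "zh j = \<tau> (zs j)" "norm (Bh (zh j) - \<beta>s (zs j)) \<le> 7 / 20 * w"
      using labels near by auto
  qed (rule bij)
qed

text \<open>From \<open>\<theta>s j\<close> to the center the gradient changes by at most
  \<open>2 / 5 * lam\<close>, so it stays below \<open>lam\<close> there and
  \<open>minimizer_eq_anchor\<close> applies.\<close>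

lemma hat_eq_center:
  assumes j: "j \<in> S" and near: "norm (Bh (zh j) - \<beta>s (zs j)) \<le> 7 / 20 * w"
  shows "\<Theta>h j = Bh (zh j)"
proof -
  have r: "regular (f j) (\<theta>s j) M \<rho> L" using reg j by blast
  have d: "norm (Bh (zh j) - \<theta>s j) \<le> 2 / 5 * w" by (rule right_center_near[OF j near])
  have "norm (grad (f j) (Bh (zh j)) - grad (f j) (\<theta>s j)) \<le> L * norm (Bh (zh j) - \<theta>s j)"
  proof (rule regular_grad_lipschitz[OF r])
    show "Bh (zh j) \<in> ecball (\<theta>s j) M"
      using d w_le unit_pos by (intro mem_ecball_if_near) auto
    have "norm (Bh (zh j) - \<theta>s j) + norm (Bh (zh j) - \<theta>s j) \<le> 6 * (lam / \<rho>)"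
      using d w_le unit_pos by linarith
    then show "ereal (norm (Bh (zh j) - \<theta>s j) + norm (Bh (zh j) - \<theta>s j)) \<le> M"
      by (intro order_trans[OF _ radius_le_M]) simp
  qed (use L_pos M_nonneg center_mem_ecball in auto)
  also have "\<dots> \<le> L * (2 / 5 * w)" using L_pos d by (intro mult_left_mono) auto
  also have "\<dots> = 2 / 5 * lam" using L_pos by (simp add: w_def)
  finally have "norm (grad (f j) (Bh (zh j))) \<le> 2 / 5 * lam + G"
    using norm_triangle_ineq[of "grad (f j) (Bh (zh j)) - grad (f j) (\<theta>s j)" "grad (f j) (\<theta>s j)"]
      grad_le_G[OF j] by simp
  then have "norm (grad (f j) (Bh (zh j))) < lam" using G_le_lam lam_pos by linarith
  then show ?thesis
    using hat_minimizes_each[OF j, of "Bh (zh j)"] by (intro minimizer_eq_anchor[OF r]) auto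
qed

lemma recovery:
  "\<exists>\<tau>. bij_betw \<tau> {1..K} {1..K} \<and> (\<forall>j\<in>S. zh j = \<tau> (zs j) \<and> \<Theta>h j = Bh (zh j))"
  using labels_recovered hat_eq_center by blast

section \<open>Error bound within one cluster\<close>

text \<open>The center \<open>Bh (\<tau> l)\<close> is moved to \<open>y\<close> together with the
  parameters of its good tasks. Their penalties stay zero, so beyond the change of their losses only
  outliers attached to this center are charged, each at most \<open>lam\<close> times the
  displacement.\<close>

lemma sum_value_slope:
  assumes \<tau>: "inj_on \<tau> {1..K}" and zh: "\<And>i. i \<in> S \<Longrightarrow> zh i = \<tau> (zs i)"
    and hat: "\<And>i. i \<in> S \<Longrightarrow> \<Theta>h i = Bh (zh i)" and l: "l \<in> {1..K}"
  shows "(\<Sum>i\<in>T l. f i (Bh (\<tau> l))) \<le> (\<Sum>i\<in>T l. f i y) + lam * out * norm (y - Bh (\<tau> l))"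
proof -
  let ?B = "Bh(\<tau> l := y)"
  let ?\<Theta> = "\<lambda>i. if i \<in> T l then y else \<Theta>h i"
  let ?h = "\<lambda>i. f i (\<Theta>h i) + lam * norm (Bh (zh i) - \<Theta>h i)"
  let ?h' = "\<lambda>i. f i (?\<Theta> i) + lam * norm (?B (zh i) - ?\<Theta> i)"
  have sub: "T l \<subseteq> S" by blast
  have "(\<Sum>i\<in>S. ?h i) \<le> (\<Sum>i\<in>S. ?h' i) + lam * (\<Sum>i\<in>{1..m} - S. norm (?B (zh i) - Bh (zh i)))"
    using hat_feas by (intro hat_compare) auto
  also have "(\<Sum>i\<in>{1..m} - S. norm (?B (zh i) - Bh (zh i))) \<le> (\<Sum>i\<in>{1..m} - S. norm (y - Bh (\<tau> l)))"
    by (rule sum_mono) auto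
  then have "lam * (\<Sum>i\<in>{1..m} - S. norm (?B (zh i) - Bh (zh i)))
    \<le> lam * (\<Sum>i\<in>{1..m} - S. norm (y - Bh (\<tau> l)))"
    using lam_pos by (intro mult_left_mono) auto
  also have "lam * (\<Sum>i\<in>{1..m} - S. norm (y - Bh (\<tau> l))) = lam * out * norm (y - Bh (\<tau> l))"
    by (simp add: out_def)
  finally have le: "(\<Sum>i\<in>S. ?h i) \<le> (\<Sum>i\<in>S. ?h' i) + lam * out * norm (y - Bh (\<tau> l))" by simp
  have "(\<Sum>i\<in>S - T l. ?h' i) = (\<Sum>i\<in>S - T l. ?h i)"
  proof (rule sum.cong)
    fix i assume i: "i \<in> S - T l"
    then have "zs i \<noteq> l" "zs i \<in> {1..K}" using S_sub zs_range by auto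
    \<comment> \<open>Injectivity of \<open>\<tau>\<close> keeps the good tasks of the other
      clusters away from the moved center.\<close>
    then have "zh i \<noteq> \<tau> l" using zh[of i] i \<tau> l by (auto dest: inj_onD)
    then show "?h' i = ?h i" using i by auto
  qed simp
  moreover have "(\<Sum>i\<in>T l. ?h' i) = (\<Sum>i\<in>T l. f i y)"
    using zh by (intro sum.cong) auto
  moreover have "(\<Sum>i\<in>T l. ?h i) = (\<Sum>i\<in>T l. f i (Bh (\<tau> l)))"
    using zh hat by (intro sum.cong) auto
  ultimately show ?thesis
    using le sum.subset_diff[OF sub finite_S, of ?h] sum.subset_diff[OF sub finite_S, of ?h'] by linarith
qed

text \<open>By \<open>sum_value_slope\<close> the gradients of the cluster at its center sum to at
  most \<open>lam * out\<close> in norm. Strong monotonicity of each \<open>f i\<close>, summed over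
  the cluster, turns this into a bound on the distance.\<close>

lemma error_bound:
  assumes j: "j \<in> S"
  shows "norm (\<Theta>h j - \<theta>s j)
    \<le> norm (\<Sum>i\<in>T (zs j). grad (f i) (\<theta>s i)) / (\<rho> * real (card (T (zs j))))
      + 2 * (L / \<rho>) * \<delta> + lam * out / (\<rho> * real (card (T (zs j))))"
proof -
  obtain \<tau> where \<tau>: "bij_betw \<tau> {1..K} {1..K}" "\<And>i. i \<in> S \<Longrightarrow> zh i = \<tau> (zs i)"
    "\<And>i. i \<in> S \<Longrightarrow> norm (Bh (zh i) - \<beta>s (zs i)) \<le> 7 / 20 * w"
    using labels_recovered by blast
  have hat: "\<Theta>h i = Bh (zh i)" if "i \<in> S" for i using hat_eq_center[OF that \<tau>(3)[OF that]] .
  define l where "l = zs j"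
  define x where "x = Bh (\<tau> l)"
  define n where "n = real (card (T l))"
  define d where "d = norm (x - \<theta>s j)"
  define g where "g = norm (\<Sum>i\<in>T l. grad (f i) (\<theta>s i))"
  have l: "l \<in> {1..K}" using j S_sub zs_range by (auto simp: l_def)
  have xj: "\<Theta>h j = x" using hat[OF j] \<tau>(2)[OF j] by (simp add: x_def l_def)
  have n: "0 < n" using card_T_ge[OF l] A_pos by (simp add: n_def)
  have slope: "norm (\<Sum>i\<in>T l. grad (f i) x) \<le> lam * out"
  proof (rule norm_gradient_le_of_slope)
    have "GDERIV (f i) x :> grad (f i) x" if "i \<in> T l" for i
      using that reg by (intro regular_GDERIV) auto
    then show "GDERIV (\<lambda>y. \<Sum>i\<in>T l. f i y) x :> (\<Sum>i\<in>T l. grad (f i) x)"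
      unfolding gderiv_def inner_sum_right by (intro has_derivative_sum)
    show "(\<Sum>i\<in>T l. f i x) \<le> (\<Sum>i\<in>T l. f i y) + lam * out * norm (y - x)" for y
      unfolding x_def by (rule sum_value_slope[OF bij_betw_imp_inj_on[OF \<tau>(1)] \<tau>(2) hat l])
  qed (use lam_pos out_nonneg in simp)
  \<comment> \<open>Monotonicity is based at the common point \<open>\<theta>s j\<close>, so that
    \<open>d\<close> does not depend on \<open>i\<close>. Replacing the gradient there by the one at
    \<open>\<theta>s i\<close> costs \<open>L\<close> times the distance, at most
    \<open>2 * \<delta>\<close>, of the two parameters.\<close>
  have each: "\<rho> * d\<^sup>2 \<le> (x - \<theta>s j) \<bullet> grad (f i) x - (x - \<theta>s j) \<bullet> grad (f i) (\<theta>s i) + d * (2 * L * \<delta>)"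
    if i: "i \<in> T l" for i
  proof -
    have iS: "i \<in> S" "zs i = zs j" using i by (auto simp: l_def)
    then have r: "regular (f i) (\<theta>s i) M \<rho> L" using reg by blast
    have ji: "norm (\<theta>s j - \<theta>s i) \<le> 2 * \<delta>"
      using bspec[OF close j] bspec[OF close iS(1)] iS(2)
        norm_triangle_ineq4[of "\<theta>s j - \<beta>s (zs j)" "\<theta>s i - \<beta>s (zs j)"] by simp
    have d4: "4 * \<delta> \<le> 6 * (lam / \<rho>)" using delta_le w_le unit_pos by linarith
    have c: "\<theta>s j \<in> ecball (\<theta>s i) M" using ji d4 delta by (intro mem_ecball_if_near) auto
    have "x \<in> ecball (\<theta>s i) M"
    proof (rule mem_ecball_if_near)
      have "norm (x - \<theta>s i) \<le> 2 / 5 * w"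
        using right_center_near[OF iS(1) \<tau>(3)[OF iS(1)]] \<tau>(2)[OF iS(1)] iS(2) by (simp add: x_def l_def)
      then show "norm (x - \<theta>s i) \<le> 6 * lam / \<rho>" using w_le unit_pos by simp
    qed
    then have "\<rho> * d\<^sup>2 \<le> (x - \<theta>s j) \<bullet> (grad (f i) x - grad (f i) (\<theta>s j))"
      unfolding d_def by (rule regular_grad_strongly_monotone[OF r c])
    moreover have "(x - \<theta>s j) \<bullet> (grad (f i) (\<theta>s i) - grad (f i) (\<theta>s j)) \<le> d * (2 * L * \<delta>)"
    proof -
      have "norm (grad (f i) (\<theta>s j) - grad (f i) (\<theta>s i)) \<le> L * norm (\<theta>s j - \<theta>s i)"
      proof (rule regular_grad_lipschitz[OF r _ c])
        show "ereal (norm (\<theta>s j - \<theta>s i) + norm (\<theta>s j - \<theta>s i)) \<le> M"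
          using ji d4 by (intro order_trans[OF _ radius_le_M]) simp
      qed (use L_pos center_mem_ecball M_nonneg in auto)
      also have "\<dots> \<le> L * (2 * \<delta>)" using ji L_pos by (intro mult_left_mono) auto
      finally have "norm (grad (f i) (\<theta>s i) - grad (f i) (\<theta>s j)) \<le> 2 * L * \<delta>"
        by (simp add: norm_minus_commute)
      then have "d * norm (grad (f i) (\<theta>s i) - grad (f i) (\<theta>s j)) \<le> d * (2 * L * \<delta>)"
        by (intro mult_left_mono) (auto simp: d_def)
      then show ?thesis
        using norm_cauchy_schwarz[of "x - \<theta>s j" "grad (f i) (\<theta>s i) - grad (f i) (\<theta>s j)"]
        unfolding d_def by linarith
    qed
    ultimately show ?thesis by (simp add: inner_diff_right)
  qed
  have "n * (\<rho> * d\<^sup>2) \<le> (\<Sum>i\<in>T l. (x - \<theta>s j) \<bullet> grad (f i) x - (x - \<theta>s j) \<bullet> grad (f i) (\<theta>s i) + d * (2 * L * \<delta>))"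
    unfolding n_def using each by (intro sum_bounded_below) auto
  also have "\<dots> = (x - \<theta>s j) \<bullet> (\<Sum>i\<in>T l. grad (f i) x) - (x - \<theta>s j) \<bullet> (\<Sum>i\<in>T l. grad (f i) (\<theta>s i))
      + n * (d * (2 * L * \<delta>))"
    by (simp add: sum.distrib sum_subtractf inner_sum_right n_def)
  finally have "n * (\<rho> * d\<^sup>2) \<le> (x - \<theta>s j) \<bullet> (\<Sum>i\<in>T l. grad (f i) x)
    - (x - \<theta>s j) \<bullet> (\<Sum>i\<in>T l. grad (f i) (\<theta>s i)) + n * (d * (2 * L * \<delta>))" .
  moreover have "(x - \<theta>s j) \<bullet> (\<Sum>i\<in>T l. grad (f i) x) \<le> d * (lam * out)"
    using norm_cauchy_schwarz[of "x - \<theta>s j" "\<Sum>i\<in>T l. grad (f i) x"] mult_left_mono[OF slope, of d]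
    by (simp add: d_def)
  moreover have "- ((x - \<theta>s j) \<bullet> (\<Sum>i\<in>T l. grad (f i) (\<theta>s i))) \<le> d * g"
    using Cauchy_Schwarz_ineq2[of "x - \<theta>s j" "\<Sum>i\<in>T l. grad (f i) (\<theta>s i)"]
    by (simp add: d_def g_def)
  ultimately have "n * (\<rho> * d\<^sup>2) \<le> d * (lam * out) + d * g + n * (d * (2 * L * \<delta>))" by linarith
  then have le: "d * (\<rho> * n * d) \<le> d * (g + 2 * L * \<delta> * n + lam * out)"
    by (simp add: power2_eq_square algebra_simps)
  have "\<rho> * n * d \<le> g + 2 * L * \<delta> * n + lam * out"
  proof (cases "d = 0")
    case True
    then show ?thesis using n L_pos delta lam_pos out_nonneg by (simp add: g_def)
  next
    case False
    then have "0 < d" by (simp add: d_def)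
    then show ?thesis using le by simp
  qed
  then have "d \<le> (g + 2 * L * \<delta> * n + lam * out) / (\<rho> * n)"
    using n rho by (simp add: pos_le_divide_eq mult_ac)
  also have "\<dots> = g / (\<rho> * n) + 2 * (L / \<rho>) * \<delta> + lam * out / (\<rho> * n)"
    using n rho by (simp add: add_divide_distrib)
  finally show ?thesis by (simp add: d_def g_def n_def xj l_def)
qed

text \<open>The first term dominates because the condition number is at least 1 and
  \<open>sqrt \<alpha>\<close> at most 1, the second because
  \<open>\<delta> <= w / 50\<close>.\<close>

lemma drift_le_min:
  "2 * (L / \<rho>) * \<delta> \<le> min (55 * (L / \<rho>)\<^sup>2 * K * \<delta> / sqrt \<alpha>) (11 * lam / (5 * \<rho>))"
proof (rule min.boundedI)
  have "2 * (L / \<rho>) * 1 * \<delta> \<le> 55 * (L / \<rho>)\<^sup>2 * K * \<delta>"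
    using kappa_ge_1 K2 delta self_le_power[of "L / \<rho>" 2] by (intro mult_mono) auto
  also have "\<dots> = 55 * (L / \<rho>)\<^sup>2 * K * \<delta> / 1" by simp
  also have "\<dots> \<le> 55 * (L / \<rho>)\<^sup>2 * K * \<delta> / sqrt \<alpha>"
    using alpha delta by (intro divide_left_mono) auto
  finally show "2 * (L / \<rho>) * \<delta> \<le> 55 * (L / \<rho>)\<^sup>2 * K * \<delta> / sqrt \<alpha>" by simp
  have "2 * (L / \<rho>) * \<delta> \<le> 2 * (L / \<rho>) * (w / 50)"
    using delta_le kappa_ge_1 by (intro mult_left_mono) auto
  also have "\<dots> = (lam / \<rho>) / 25" using L_pos by (simp add: w_def)
  also have "\<dots> \<le> 11 / 5 * (lam / \<rho>)" using unit_pos by simp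
  finally show "2 * (L / \<rho>) * \<delta> \<le> 11 * lam / (5 * \<rho>)" by simp
qed

end

section \<open>Assembly of the two regimes of \<delta>\<close>

theorem theoremA4:
  fixes f :: "nat \<Rightarrow> 'a::euclidean_space \<Rightarrow> real"
    and m K :: nat and \<epsilon> \<delta> \<rho> L \<alpha> lam :: real and M :: ereal
    and \<beta>s \<theta>s :: "nat \<Rightarrow> 'a" and zs :: "nat \<Rightarrow> nat" and S :: "nat set"
    and \<Theta>h Bh :: "nat \<Rightarrow> 'a" and zh :: "nat \<Rightarrow> nat"
  assumes eps: "\<epsilon> \<ge> 0" and delta: "\<delta> \<ge> 0"
    and M_pos: "0 < M"
    and rho: "0 < \<rho>" "\<rho> \<le> L"
    and K2: "K \<ge> 2"
    and alpha: "0 < \<alpha>" "\<alpha> \<le> 1"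
    and zs_range: "\<forall>j\<in>{1..m}. zs j \<in> {1..K}"
    and S_sub: "S \<subseteq> {1..m}"
    and reg: "\<forall>j\<in>S. regular (f j) (\<theta>s j) M \<rho> L"
    and diff_Sc: "\<forall>j\<in>{1..m} - S. f j differentiable (at (\<theta>s j))"
    and close: "\<forall>j\<in>S. norm (\<theta>s j - \<beta>s (zs j)) \<le> \<delta>"
    and Sc_card: "real (card ({1..m} - S)) \<le> \<epsilon> * real m"
    and eps_small: "\<epsilon> \<le> \<alpha> / (6 * (L / \<rho>) * real K ^ 2)"
    and T_large: "\<forall>k\<in>{1..K}. real (card {j\<in>{1..m}. zs j = k}) \<ge> 7 * \<alpha> * real m / (6 * real K)"
    and lam_lower: "\<forall>j\<in>{1..m}. 12 * (L / \<rho>) * real K / sqrt \<alpha> * norm (grad (f j) (\<theta>s j)) < lam"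
    and lam_upper_M: "ereal lam < ereal (\<rho> / 6) * M"
    and lam_upper_sep: "\<forall>k\<in>{1..K}. \<forall>l\<in>{1..K}. k \<noteq> l \<longrightarrow> lam < \<rho> / 6 * norm (\<beta>s k - \<beta>s l)"
    and hat_feas: "feasible_z m K \<alpha> zh"
    and hat_min: "\<forall>\<Theta> B z. feasible_z m K \<alpha> z \<longrightarrow>
                    objective m f lam \<Theta>h Bh zh \<le> objective m f lam \<Theta> B z"
  shows "(\<forall>j\<in>S.
            norm (\<Theta>h j - \<theta>s j)
              \<le> norm (\<Sum>i\<in>{i\<in>{1..m}. zs i = zs j} \<inter> S. grad (f i) (\<theta>s i))
                   / (\<rho> * real (card ({i\<in>{1..m}. zs i = zs j} \<inter> S)))
                + min (55 * (L / \<rho>)\<^sup>2 * real K * \<delta> / sqrt \<alpha>) (11 * lam / (5 * \<rho>))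
                + lam * real (card ({1..m} - S))
                   / (\<rho> * real (card ({i\<in>{1..m}. zs i = zs j} \<inter> S))))
       \<and> (\<delta> \<le> sqrt \<alpha> * lam / (100 * (L / \<rho>) * real K * L) \<longrightarrow>
            (\<exists>\<tau>. bij_betw \<tau> {1..K} {1..K} \<and>
                  (\<forall>j\<in>S. zh j = \<tau> (zs j) \<and> \<Theta>h j = Bh (zh j))))"
proof (cases "m = 0")
  case True
  then have "S = {}" using S_sub by simp
  moreover have "\<exists>\<tau>. bij_betw \<tau> {1..K} {1..K}" using bij_betw_id by blast
  ultimately show ?thesis by blast
next
  case False
  then have "0 < m" by simp
  interpret clustered_minimizer f m K \<epsilon> \<delta> \<rho> L \<alpha> lam M \<beta>s \<theta>s zs S \<Theta>h Bh zh
    by unfold_locales fact+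
  define thr where "thr = sqrt \<alpha> * lam / (25 * (L / \<rho>) * real K * L)"
  show ?thesis
  proof (cases "\<delta> \<le> thr")
    case True
    then interpret clustered_minimizer_close f m K \<epsilon> \<delta> \<rho> L \<alpha> lam M \<beta>s \<theta>s zs S \<Theta>h Bh zh
      by unfold_locales (simp add: thr_def)
    show ?thesis
    proof (intro conjI ballI impI)
      fix j assume "j \<in> S"
      from error_bound[OF this, unfolded out_def] drift_le_min
      show "norm (\<Theta>h j - \<theta>s j)
              \<le> norm (\<Sum>i\<in>T (zs j). grad (f i) (\<theta>s i)) / (\<rho> * real (card (T (zs j))))
                + min (55 * (L / \<rho>)\<^sup>2 * real K * \<delta> / sqrt \<alpha>) (11 * lam / (5 * \<rho>))
                + lam * real (card ({1..m} - S)) / (\<rho> * real (card (T (zs j))))"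
        by linarith
    qed (rule recovery)
  next
    \<comment> \<open>Here the minimum equals its second term, so \<open>hat_near\<close> alone
      gives the bound. The recovery claim is vacuous, as its threshold is
      \<open>thr / 4\<close>.\<close>
    case False
    have "sqrt \<alpha> * lam / (100 * (L / \<rho>) * real K * L) = thr / 4" by (simp add: thr_def)
    moreover have "0 \<le> thr" using alpha lam_pos rho L_pos by (simp add: thr_def)
    ultimately have small: "\<not> \<delta> \<le> sqrt \<alpha> * lam / (100 * (L / \<rho>) * real K * L)"
      using False by linarith
    have "11 * lam / (5 * \<rho>) \<le> 55 * (L / \<rho>)\<^sup>2 * real K * \<delta> / sqrt \<alpha>"
      by (rule min_eq_if_delta_large) (use False in \<open>simp add: thr_def\<close>)
    then have min: "min (55 * (L / \<rho>)\<^sup>2 * real K * \<delta> / sqrt \<alpha>) (11 * lam / (5 * \<rho>)) = 11 * lam / (5 * \<rho>)"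
      by (rule min.absorb2)
    show ?thesis
    proof (intro conjI ballI impI)
      fix j assume j: "j \<in> S"
      have "0 \<le> norm (\<Sum>i\<in>T (zs j). grad (f i) (\<theta>s i)) / (\<rho> * real (card (T (zs j))))"
        and "0 \<le> lam * real (card ({1..m} - S)) / (\<rho> * real (card (T (zs j))))"
        using rho(1) lam_pos by auto
      then show "norm (\<Theta>h j - \<theta>s j)
              \<le> norm (\<Sum>i\<in>T (zs j). grad (f i) (\<theta>s i)) / (\<rho> * real (card (T (zs j))))
                + min (55 * (L / \<rho>)\<^sup>2 * real K * \<delta> / sqrt \<alpha>) (11 * lam / (5 * \<rho>))
                + lam * real (card ({1..m} - S)) / (\<rho> * real (card (T (zs j))))"
        using hat_near[OF j] unfolding min by linarith
    qed (use small in blast)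
  qed
qed

end
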